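(* Let $(X,d)$ be a metric space, $I\subseteq\mathbb{R}$ an open interval, $f:I\to(0,\infty)$ continuous and $Y=I\times_f X$. Let $\gamma_n=(\alpha_n,\beta_n)$ ($n\in\mathbb{N}$) and $\gamma=(\alpha,\beta):[a,b]\to Y$ be absolutely continuous curves such that each $\gamma_n$ is future directed causal (respectively each $\gamma_n$ is past directed causal). Suppose $\dot\alpha\neq0$ almost everywhere and $\gamma_n\to\gamma$ pointwise. Then $\gamma$ is causal.
   Context: $Y=I\times X$ with metric $D((t,x),(t',x'))=|t-t'|+d(x,x')$; absolute continuity is with respect to $D$, and for $\gamma=(\alpha,\beta)$ absolutely continuous the metric derivative $v_\beta$ exists a.e. A curve $\gamma=(\alpha,\beta)$ is causal if it is absolutely continuous, $\alpha$ is strictly monotone, and $-\dot\alpha^2+(f\circ\alpha)^2v_\beta^2\le0$ a.e.; it is future (past) directed if $\dot\alpha>0$ ($\dot\alpha<0$) a.e. *)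

theory Defs
  imports "HOL-Analysis.Analysis"
begin

text \<open>The product metric on Y = I x_f X:  D((t,x),(t',x')) = |t - t'| + d(x,x').
  A curve gamma = (alpha, beta) is represented by its two components.\<close>

definition Dmet :: "real \<times> 'a::metric_space \<Rightarrow> real \<times> 'a \<Rightarrow> real" where
  "Dmet p q = \<bar>fst p - fst q\<bar> + dist (snd p) (snd q)"

definition abs_cont_curve ::
  "real \<Rightarrow> real \<Rightarrow> (real \<Rightarrow> real) \<Rightarrow> (real \<Rightarrow> 'a::metric_space) \<Rightarrow> bool" where
  "abs_cont_curve a b \<alpha> \<beta> \<longleftrightarrow>
     (\<forall>\<epsilon>>0. \<exists>\<delta>>0. \<forall>(n::nat) (u::nat \<Rightarrow> real) (v::nat \<Rightarrow> real).
        (\<forall>i<n. a \<le> u i \<and> u i \<le> v i \<and> v i \<le> b) \<and>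
        (\<forall>i<n. \<forall>j<n. i \<noteq> j \<longrightarrow> v i \<le> u j \<or> v j \<le> u i) \<and>
        (\<Sum>i<n. v i - u i) < \<delta>
        \<longrightarrow> (\<Sum>i<n. Dmet (\<alpha> (u i), \<beta> (u i)) (\<alpha> (v i), \<beta> (v i))) < \<epsilon>)"

definition has_metric_derivative ::
  "real \<Rightarrow> real \<Rightarrow> (real \<Rightarrow> 'a::metric_space) \<Rightarrow> real \<Rightarrow> real \<Rightarrow> bool" where
  "has_metric_derivative a b \<beta> v t \<longleftrightarrow>
     ((\<lambda>s. dist (\<beta> s) (\<beta> t) / \<bar>s - t\<bar>) \<longlongrightarrow> v) (at t within {a..b})"

definition causal ::
  "(real \<Rightarrow> real) \<Rightarrow> real \<Rightarrow> real \<Rightarrow> (real \<Rightarrow> real) \<Rightarrow> (real \<Rightarrow> 'a::metric_space) \<Rightarrow> bool" where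
  "causal f a b \<alpha> \<beta> \<longleftrightarrow>
     abs_cont_curve a b \<alpha> \<beta> \<and>
     ((\<forall>s\<in>{a..b}. \<forall>t\<in>{a..b}. s < t \<longrightarrow> \<alpha> s < \<alpha> t) \<or>
      (\<forall>s\<in>{a..b}. \<forall>t\<in>{a..b}. s < t \<longrightarrow> \<alpha> s > \<alpha> t)) \<and>
     (AE t in lebesgue. t \<in> {a..b} \<longrightarrow>
        (\<exists>da v. (\<alpha> has_real_derivative da) (at t) \<and> has_metric_derivative a b \<beta> v t \<and>
                - (da\<^sup>2) + (f (\<alpha> t))\<^sup>2 * v\<^sup>2 \<le> 0))"

definition future_directed_causal ::
  "(real \<Rightarrow> real) \<Rightarrow> real \<Rightarrow> real \<Rightarrow> (real \<Rightarrow> real) \<Rightarrow> (real \<Rightarrow> 'a::metric_space) \<Rightarrow> bool" where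
  "future_directed_causal f a b \<alpha> \<beta> \<longleftrightarrow>
     causal f a b \<alpha> \<beta> \<and>
     (AE t in lebesgue. t \<in> {a..b} \<longrightarrow> (\<exists>da. (\<alpha> has_real_derivative da) (at t) \<and> da > 0))"

definition past_directed_causal ::
  "(real \<Rightarrow> real) \<Rightarrow> real \<Rightarrow> real \<Rightarrow> (real \<Rightarrow> real) \<Rightarrow> (real \<Rightarrow> 'a::metric_space) \<Rightarrow> bool" where
  "past_directed_causal f a b \<alpha> \<beta> \<longleftrightarrow>
     causal f a b \<alpha> \<beta> \<and>
     (AE t in lebesgue. t \<in> {a..b} \<longrightarrow> (\<exists>da. (\<alpha> has_real_derivative da) (at t) \<and> da < 0))"

end

theory Submission
  imports Defs
begin

text \<open>
  If \<open>f \<ge> m > 0\<close> on the range of a future directed causal curve \<open>(\<alpha>, \<beta>)\<close>, then integrating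
  \<open>v\<^sub>\<beta> \<le> \<alpha>' / f(\<alpha>)\<close> gives \<open>d(\<beta> s, \<beta> t) \<le> (\<alpha> t - \<alpha> s) / m\<close>, a condition that survives pointwise
  limits. Localising it near \<open>t\<close>, with \<open>m\<close> close to \<open>f(\<alpha> t)\<close>, gives the causality inequality for the
  limit wherever its metric derivative exists; monotonicity of the limit is strict because its
  derivative does not vanish on any interval. The metric derivative exists almost everywhere because
  the difference quotients of a rectifiable curve cannot oscillate between two values \<open>p < q\<close> on a
  set of positive measure. The past directed case follows by reversing the sign of \<open>\<alpha>\<close>.
\<close>

text \<open>Causality of the limit includes the existence of its metric derivative almost
  everywhere, and X is an arbitrary metric space, so there is nothing to differentiate in X itself.
  Existence is therefore drawn from arc length alone. The limiting bound by the increments of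
  \<alpha> / m does two jobs here: it makes \<beta> rectifiable, and it keeps the difference
  quotients of \<beta> bounded near every interior point where \<alpha> is differentiable. Bounded
  quotients that do not oscillate across any rational gap converge. Pointwise convergence gives no
  information on derivatives, which is why the causality inequality has to be integrated between two
  parameters before passing to the limit, and then differentiated again.\<close>

section \<open>Superadditive interval functions summed over nonoverlapping intervals\<close>

text \<open>Intervals may share end points, as in \<open>abs_cont_curve\<close>, but may not be
  degenerate: a one-point interval could lie on both sides of a cut, and splitting a sum at that cut
  would count it twice.\<close>

definition nonoverlapping :: "(real \<times> real) set \<Rightarrow> bool" where
  "nonoverlapping F \<longleftrightarrow>
     (\<forall>p\<in>F. fst p < snd p) \<and> pairwise (\<lambda>p q. snd p \<le> fst q \<or> snd q \<le> fst p) F"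

lemma nonoverlapping_subset: "nonoverlapping F \<Longrightarrow> G \<subseteq> F \<Longrightarrow> nonoverlapping G"
  unfolding nonoverlapping_def by (meson pairwise_subset subset_iff)

text \<open>Any member r of F splits the others into those to its left and those to its right. Both
  parts are handled by induction on proper subsets, and superadditivity joins the three pieces.
  Nonnegativity pays for the gaps, where no interval is left.\<close>

lemma sum_superadditive_le:
  fixes e :: "real \<Rightarrow> real \<Rightarrow> real"
  assumes super: "\<And>x y z. c \<le> x \<Longrightarrow> x \<le> y \<Longrightarrow> y \<le> z \<Longrightarrow> z \<le> d \<Longrightarrow> e x y + e y z \<le> e x z"
    and nonneg: "\<And>x y. c \<le> x \<Longrightarrow> x \<le> y \<Longrightarrow> y \<le> d \<Longrightarrow> 0 \<le> e x y"
    and "finite F" "nonoverlapping F" "\<And>p. p \<in> F \<Longrightarrow> x \<le> fst p \<and> snd p \<le> y"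
    and "c \<le> x" "x \<le> y" "y \<le> d"
  shows "(\<Sum>p\<in>F. e (fst p) (snd p)) \<le> e x y"
  using assms(3-)
proof (induction F arbitrary: x y rule: finite_psubset_induct)
  case (psubset F)
  show ?case
  proof (cases "F = {}")
    case True
    then show ?thesis using nonneg psubset.prems by simp
  next
    case False
    then obtain r where r: "r \<in> F" by blast
    define A B where "A = {p\<in>F. snd p \<le> fst r}" and "B = {p\<in>F. snd r \<le> fst p}"
    have lt: "\<And>p. p \<in> F \<Longrightarrow> fst p < snd p"
      using psubset.prems(1) by (simp add: nonoverlapping_def)
    have F: "F = insert r (A \<union> B)"
      using psubset.prems(1) r by (fastforce simp: A_def B_def nonoverlapping_def pairwise_def)
    have rb: "x \<le> fst r" "fst r < snd r" "snd r \<le> y"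
      using psubset.prems(2) r lt by auto
    have "r \<notin> A" "r \<notin> B" using rb by (auto simp: A_def B_def)
    have "A \<inter> B = {}" using lt rb by (fastforce simp: A_def B_def)
    have fin: "finite A" "finite B" using \<open>finite F\<close> by (auto simp: A_def B_def)
    have AF: "A \<subset> F" "B \<subset> F" using \<open>r \<notin> A\<close> \<open>r \<notin> B\<close> r by (auto simp: A_def B_def)
    have "(\<Sum>p\<in>A. e (fst p) (snd p)) \<le> e x (fst r)"
      by (rule psubset.IH[OF AF(1)])
        (use psubset.prems rb AF in \<open>auto simp: A_def intro: nonoverlapping_subset\<close>)
    moreover have "(\<Sum>p\<in>B. e (fst p) (snd p)) \<le> e (snd r) y"
      by (rule psubset.IH[OF AF(2)])
        (use psubset.prems rb AF in \<open>auto simp: B_def intro: nonoverlapping_subset\<close>)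
    moreover have "(\<Sum>p\<in>F. e (fst p) (snd p))
        = e (fst r) (snd r) + ((\<Sum>p\<in>A. e (fst p) (snd p)) + (\<Sum>p\<in>B. e (fst p) (snd p)))"
      using \<open>r \<notin> A\<close> \<open>r \<notin> B\<close> \<open>A \<inter> B = {}\<close> fin
      by (subst F) (simp add: sum.union_disjoint)
    moreover have "e x (fst r) + e (fst r) (snd r) \<le> e x (snd r)"
      using super[of x "fst r" "snd r"] psubset.prems rb by simp
    moreover have "e x (snd r) + e (snd r) y \<le> e x y"
      using super[of x "snd r" y] psubset.prems rb by simp
    ultimately show ?thesis by linarith
  qed
qed

fun chain_sum :: "(real \<Rightarrow> real \<Rightarrow> real) \<Rightarrow> real list \<Rightarrow> real" where
  "chain_sum e (x # y # zs) = e x y + chain_sum e (y # zs)"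
| "chain_sum e _ = 0"

lemma chain_sum_snoc: "chain_sum e (xs @ [s, t]) = chain_sum e (xs @ [s]) + e s t"
  by (induction xs rule: induct_list012) auto

lemma chain_sum_diff:
  "chain_sum (\<lambda>s t. e s t - e' s t) xs = chain_sum e xs - chain_sum e' xs"
  by (induction xs rule: induct_list012) auto

lemma chain_sum_telescope:
  "chain_sum (\<lambda>s t. L t - L s) (x # xs) = L (last (x # xs)) - L x"
  by (induction xs arbitrary: x) auto

lemma chain_sum_mono:
  assumes "sorted xs" "set xs \<subseteq> {a..b}"
    and "\<And>s t. a \<le> s \<Longrightarrow> s \<le> t \<Longrightarrow> t \<le> b \<Longrightarrow> e s t \<le> e' s t"
  shows "chain_sum e xs \<le> chain_sum e' xs"
  using assms(1,2)
  by (induction xs rule: induct_list012) (auto intro!: add_mono assms(3))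

text \<open>No partition point is interior to a member of F, so every member lies in one cell and
  the previous bound applies cell by cell. It is meant for the excess of arc length over chord
  length, which is superadditive by the triangle inequality: the excess on F is then at most that of
  the whole partition.\<close>

lemma sum_le_chain_sum:
  fixes e :: "real \<Rightarrow> real \<Rightarrow> real"
  assumes super: "\<And>x y z. c \<le> x \<Longrightarrow> x \<le> y \<Longrightarrow> y \<le> z \<Longrightarrow> z \<le> d \<Longrightarrow> e x y + e y z \<le> e x z"
    and nonneg: "\<And>x y. c \<le> x \<Longrightarrow> x \<le> y \<Longrightarrow> y \<le> d \<Longrightarrow> 0 \<le> e x y"
    and "finite F" "nonoverlapping F"
    and "\<And>p. p \<in> F \<Longrightarrow> x \<le> fst p \<and> snd p \<le> last (x # xs)"
    and "\<And>p z. p \<in> F \<Longrightarrow> z \<in> set xs \<Longrightarrow> z \<le> fst p \<or> snd p \<le> z"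
    and "sorted (x # xs)" "set (x # xs) \<subseteq> {c..d}"
  shows "(\<Sum>p\<in>F. e (fst p) (snd p)) \<le> chain_sum e (x # xs)"
  using assms(3-)
proof (induction xs arbitrary: x F)
  case Nil
  have "F = {}"
  proof (rule ccontr)
    assume "F \<noteq> {}"
    then obtain p where "p \<in> F" by blast
    with Nil show False by (fastforce simp: nonoverlapping_def)
  qed
  then show ?case by simp
next
  case (Cons y zs)
  define A B where "A = {p\<in>F. snd p \<le> y}" and "B = {p\<in>F. y \<le> fst p}"
  have F: "F = A \<union> B" using Cons.prems(4) by (auto simp: A_def B_def)
  have AB: "A \<subseteq> F" "B \<subseteq> F" by (auto simp: A_def B_def)
  have "A \<inter> B = {}"
    using Cons.prems(2) by (fastforce simp: A_def B_def nonoverlapping_def)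
  have fin: "finite A" "finite B" using Cons.prems(1) F by auto
  have "(\<Sum>p\<in>A. e (fst p) (snd p)) \<le> e x y"
    by (rule sum_superadditive_le[where c = c and d = d, OF super nonneg])
      (use Cons.prems fin AB in \<open>auto simp: A_def intro: nonoverlapping_subset\<close>)
  moreover have "(\<Sum>p\<in>B. e (fst p) (snd p)) \<le> chain_sum e (y # zs)"
    by (rule Cons.IH)
      (use Cons.prems fin AB in \<open>auto simp: B_def intro: nonoverlapping_subset\<close>)
  ultimately show ?case
    using F \<open>A \<inter> B = {}\<close> fin by (simp add: sum.union_disjoint)
qed

section \<open>Arc length of a curve with dominated increments\<close>

text \<open>L is the arc length from a, the supremum of chord sums, finite because the increments of
  G dominate the chords. As the increments of L telescope, a chain nearly attaining the supremum at
  b has small total excess of arc length over chords.\<close>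

lemma length_function_exists:
  fixes \<beta> :: "real \<Rightarrow> 'a::metric_space" and G :: "real \<Rightarrow> real"
  assumes "a \<le> b"
    and dom: "\<And>s t. a \<le> s \<Longrightarrow> s \<le> t \<Longrightarrow> t \<le> b \<Longrightarrow> dist (\<beta> s) (\<beta> t) \<le> G t - G s"
  shows "\<exists>L. (\<forall>s t. a \<le> s \<longrightarrow> s \<le> t \<longrightarrow> t \<le> b \<longrightarrow> dist (\<beta> s) (\<beta> t) \<le> L t - L s) \<and>
    (\<forall>\<epsilon>>0. \<exists>xs. sorted (a # xs @ [b]) \<and>
        chain_sum (\<lambda>s t. L t - L s - dist (\<beta> s) (\<beta> t)) (a # xs @ [b]) < \<epsilon>)"
proof -
  define d where "d = (\<lambda>s t. dist (\<beta> s) (\<beta> t))"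
  define P where "P = (\<lambda>t. {xs. sorted (a # xs @ [t])})"
  \<comment> \<open>The value at a is fixed by hand, which bypasses the degenerate chains from a to
    a and causes the case distinctions below.\<close>
  define L where "L = (\<lambda>t. if t = a then 0 else SUP xs\<in>P t. chain_sum d (a # xs @ [t]))"
  have bdd: "chain_sum d (a # xs @ [t]) \<le> G t - G a" if "xs \<in> P t" "t \<le> b" for xs t
  proof -
    have "chain_sum d (a # xs @ [t]) \<le> chain_sum (\<lambda>s t. G t - G s) (a # xs @ [t])"
      by (rule chain_sum_mono[where a = a and b = b])
        (use that in \<open>fastforce simp: P_def sorted_append d_def dom\<close>)+
    then show ?thesis by (simp only: chain_sum_telescope) simp
  qed
  have ne: "P t \<noteq> {}" if "a \<le> t" for t
  proof -
    have "[] \<in> P t" using that by (simp add: P_def)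
    then show ?thesis by blast
  qed
  have BA: "bdd_above ((\<lambda>xs. chain_sum d (a # xs @ [t])) ` P t)" if "t \<le> b" for t
    using bdd that by (auto intro!: bdd_aboveI2)
  have step: "d s t \<le> L t - L s" if st: "a \<le> s" "s \<le> t" "t \<le> b" for s t
  proof (cases "s = a")
    case True
    show ?thesis
    proof (cases "t = a")
      case False
      have "chain_sum d (a # [] @ [t]) \<le> L t"
        unfolding L_def using False st
        by (simp, intro cSUP_upper2[OF BA, where x = "[]"]) (auto simp: P_def)
      then show ?thesis using True by (simp add: L_def)
    qed (use True in \<open>simp add: d_def\<close>)
  next
    case False
    then have "t \<noteq> a" using st by simp
    have "chain_sum d (a # xs @ [s]) + d s t \<le> L t" if "xs \<in> P s" for xs
    proof -
      have "xs @ [s] \<in> P t" using that st by (auto simp: P_def sorted_append)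
      then have "chain_sum d (a # (xs @ [s]) @ [t]) \<le> L t"
        unfolding L_def using \<open>t \<noteq> a\<close> by (simp only: if_False, intro cSUP_upper BA st)
      then show ?thesis using chain_sum_snoc[of d "a # xs" s t] by simp
    qed
    then have "(SUP xs\<in>P s. chain_sum d (a # xs @ [s])) \<le> L t - d s t"
      by (intro cSUP_least ne st) (simp add: algebra_simps)
    then show ?thesis using False by (simp add: L_def)
  qed
  have near: "\<exists>xs. sorted (a # xs @ [b]) \<and>
      chain_sum (\<lambda>s t. L t - L s - d s t) (a # xs @ [b]) < \<epsilon>" if "\<epsilon> > 0" for \<epsilon>
  proof (cases "a = b")
    case True
    then show ?thesis using that by (intro exI[of _ "[]"]) (simp add: d_def)
  next
    case False
    then have "L b - \<epsilon> < (SUP xs\<in>P b. chain_sum d (a # xs @ [b]))"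
      using that by (simp add: L_def)
    then obtain xs where xs: "xs \<in> P b" "L b - \<epsilon> < chain_sum d (a # xs @ [b])"
      using less_cSUP_iff[OF ne BA] \<open>a \<le> b\<close> by auto
    have "chain_sum (\<lambda>s t. L t - L s - d s t) (a # xs @ [b])
        = L b - L a - chain_sum d (a # xs @ [b])"
      using chain_sum_diff[of "\<lambda>s t. L t - L s" d] chain_sum_telescope[of L a "xs @ [b]"] by simp
    also have "L a = 0" by (simp add: L_def)
    finally show ?thesis using xs by (auto simp: P_def)
  qed
  show ?thesis
    using step near unfolding d_def by blast
qed

section \<open>Vitali coverings by finitely many intervals\<close>

lemma nonoverlapping_union_measure:
  assumes "finite F" "nonoverlapping F"
  shows "(\<Union>p\<in>F. {fst p<..<snd p}) \<in> lmeasurable"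
    "measure lebesgue (\<Union>p\<in>F. {fst p<..<snd p}) = (\<Sum>p\<in>F. snd p - fst p)"
proof -
  show "(\<Union>p\<in>F. {fst p<..<snd p}) \<in> lmeasurable"
    using assms by (intro fmeasurable.finite_UN) auto
  have "measure lebesgue (\<Union>p\<in>F. {fst p<..<snd p}) = (\<Sum>p\<in>F. measure lebesgue {fst p<..<snd p})"
  proof (rule measure_finite_Union)
    show "disjoint_family_on (\<lambda>p. {fst p<..<snd p}) F"
      using assms(2) unfolding disjoint_family_on_def nonoverlapping_def pairwise_def
      by fastforce
    show "emeasure lebesgue {fst p<..<snd p} \<noteq> \<infinity>" if "p \<in> F" for p
    proof -
      have "fst p \<le> snd p" using that assms(2) by (auto simp: nonoverlapping_def less_imp_le)
      then show ?thesis by simp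
    qed
  qed (use assms in auto)
  also have "\<dots> = (\<Sum>p\<in>F. snd p - fst p)"
    using assms(2) by (intro sum.cong) (auto simp: nonoverlapping_def measure_completion)
  finally show "measure lebesgue (\<Union>p\<in>F. {fst p<..<snd p}) = (\<Sum>p\<in>F. snd p - fst p)" .
qed

lemma nonoverlapping_sum_le_measure:
  assumes "finite F" "nonoverlapping F" "(\<Union>p\<in>F. {fst p<..<snd p}) \<subseteq> W" "W \<in> lmeasurable"
  shows "(\<Sum>p\<in>F. snd p - fst p) \<le> measure lebesgue W"
  using measure_mono_fmeasurable[of "\<Union>p\<in>F. {fst p<..<snd p}" W lebesgue]
    nonoverlapping_union_measure[OF assms(1,2)] assms(3,4) by auto

text \<open>The intervals need only contain \<open>t\<close>, possibly as an end point; the null set of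
  end points is what makes open intervals suffice in the conclusion.\<close>

lemma Vitali_finite_intervals:
  assumes S: "S \<in> lmeasurable" and "\<epsilon> > 0"
    and R: "\<And>t \<eta>. t \<in> S \<Longrightarrow> \<eta> > 0 \<Longrightarrow> \<exists>u v. u < v \<and> u \<le> t \<and> t \<le> v \<and> v - u < \<eta> \<and> R u v"
  obtains F where "finite F" "nonoverlapping F" "\<And>p. p \<in> F \<Longrightarrow> R (fst p) (snd p)"
    "measure lebesgue S - \<epsilon> < measure lebesgue (S \<inter> (\<Union>p\<in>F. {fst p<..<snd p}))"
proof -
  define K where "K = {p. fst p < snd p \<and> R (fst p) (snd p)}"
  \<comment> \<open>An interval is the closed ball about its midpoint, which makes the covering
    theorem for balls applicable.\<close>
  define c r :: "real \<times> real \<Rightarrow> real"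
    where "c = (\<lambda>p. (fst p + snd p) / 2)" and "r = (\<lambda>p. (snd p - fst p) / 2)"
  have cb: "cball (c p) (r p) = {fst p..snd p}" for p
    by (auto simp: c_def r_def cball_eq_atLeastAtMost field_simps)
  obtain C where C: "countable C" "C \<subseteq> K"
     "pairwise (\<lambda>i j. disjnt (cball (c i) (r i)) (cball (c j) (r j))) C"
     "negligible (S - (\<Union>i\<in>C. cball (c i) (r i)))"
  proof (rule Vitali_covering_theorem_cballs[of K r S c])
    show "0 < r i" if "i \<in> K" for i using that by (simp add: K_def r_def)
    show "\<exists>i. i \<in> K \<and> x \<in> cball (c i) (r i) \<and> r i < d" if xd: "x \<in> S" "d > 0" for x d
    proof -
      obtain u v where "u < v" "u \<le> x" "x \<le> v" "v - u < d" "R u v" using R[OF xd] by blast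
      then show ?thesis
        unfolding cb by (intro exI[of _ "(u, v)"]) (auto simp: K_def r_def)
    qed
  qed
  define O' where "O' = (\<lambda>G. S \<inter> (\<Union>p\<in>G. {fst p<..<snd p}))"
  have neg: "negligible (S - O' C)"
  proof (rule negligible_subset)
    have "negligible (fst ` C \<union> snd ` C)"
      using C(1) by (simp add: negligible_iff_null_sets countable_imp_null_set_lborel null_sets_completionI)
    then show "negligible ((S - (\<Union>i\<in>C. cball (c i) (r i))) \<union> (fst ` C \<union> snd ` C))"
      using C(4) negligible_Un by blast
    show "S - O' C \<subseteq> (S - (\<Union>i\<in>C. cball (c i) (r i))) \<union> (fst ` C \<union> snd ` C)"
      unfolding cb O'_def by (auto simp: image_iff) (metis fst_conv snd_conv order_le_less)
  qed
  have no: "nonoverlapping C"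
    unfolding nonoverlapping_def
  proof (intro conjI ballI pairwiseI)
    show "fst p < snd p" if "p \<in> C" for p using that C(2) by (auto simp: K_def)
    show "snd p \<le> fst q \<or> snd q \<le> fst p" if "p \<in> C" "q \<in> C" "p \<noteq> q" for p q
    proof -
      have "disjnt {fst p..snd p} {fst q..snd q}"
        using C(3) that unfolding cb pairwise_def by blast
      moreover have "fst p < snd p" "fst q < snd q" using that C(2) by (auto simp: K_def)
      ultimately show ?thesis
        unfolding disjnt_def by (metis disjoint_iff atLeastAtMost_iff linorder_not_le order_less_imp_le order_refl)
    qed
  qed
  have meas: "O' G \<in> lmeasurable" if "G \<subseteq> C" for G
    unfolding O'_def using S
    by (intro fmeasurable_Int_fmeasurable sets.countable_UN'' countable_subset[OF that C(1)]) auto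
  have eq: "measure lebesgue (O' C) = measure lebesgue S"
  proof (rule measure_negligible_symdiff[OF S])
    have "O' C - S = {}" by (auto simp: O'_def)
    then show "negligible (S - O' C \<union> (O' C - S))" using neg by simp
  qed
  show thesis
  proof (cases "C = {}")
    case True
    then show thesis
      using eq \<open>\<epsilon> > 0\<close> by (intro that[of "{}"]) (auto simp: O'_def nonoverlapping_def)
  next
    case False
    \<comment> \<open>Finite initial segments of an enumeration exhaust C, and continuity of the
      measure from below finds one that loses less than \<epsilon>. If C is finite,
      \<open>from_nat_into\<close> repeats members, which does not affect the images; it needs C
      nonempty.\<close>
    define G where "G = (\<lambda>n::nat. from_nat_into C ` {..<n})"
    have GC: "G n \<subseteq> C" for n using from_nat_into[OF False] by (auto simp: G_def)
    have "(\<Union>n. G n) = range (from_nat_into C)" by (auto simp: G_def)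
    then have "(\<Union>n. G n) = C" using range_from_nat_into[OF False C(1)] by simp
    then have UG: "(\<Union>n. O' (G n)) = O' C" unfolding O'_def by blast
    have "(\<lambda>n. measure lebesgue (O' (G n))) \<longlonglongrightarrow> measure lebesgue (\<Union>n. O' (G n))"
    proof (rule Lim_measure_incseq)
      show "range (\<lambda>n. O' (G n)) \<subseteq> sets lebesgue" using meas GC by blast
      show "incseq (\<lambda>n. O' (G n))" by (auto simp: incseq_def O'_def G_def intro: order_less_le_trans)
      show "emeasure lebesgue (\<Union>n. O' (G n)) \<noteq> \<infinity>"
        unfolding UG using meas[of C] by (auto simp: fmeasurable_def less_top)
    qed
    then have "eventually (\<lambda>n. measure lebesgue S - \<epsilon> < measure lebesgue (O' (G n))) sequentially"
      unfolding UG eq by (rule order_tendstoD) (use \<open>\<epsilon> > 0\<close> in simp)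
    then obtain n where "measure lebesgue S - \<epsilon> < measure lebesgue (O' (G n))"
      by (auto simp: eventually_sequentially)
    then show thesis
      using GC[of n] C(2) no
      by (intro that[of "G n"]) (auto simp: O'_def G_def K_def intro: nonoverlapping_subset)
  qed
qed

section \<open>Oscillation of difference quotients\<close>

text \<open>A point s near t spans an interval with t as one of its end points, on a side that
  cannot be prescribed. This is the form of interval that the coverings have to accept.\<close>

lemma frequently_at_interval:
  fixes \<beta> :: "real \<Rightarrow> 'a::metric_space"
  assumes "\<exists>\<^sub>F s in at t. Q (dist (\<beta> s) (\<beta> t)) \<bar>s - t\<bar>" "\<eta> > 0"
  shows "\<exists>u v. u < v \<and> u \<le> t \<and> t \<le> v \<and> v - u < \<eta> \<and> Q (dist (\<beta> u) (\<beta> v)) (v - u)"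
proof -
  obtain s where s: "s \<noteq> t" "dist s t < \<eta>" "Q (dist (\<beta> s) (\<beta> t)) \<bar>s - t\<bar>"
    using assms unfolding frequently_at by blast
  show ?thesis
  proof (cases "s < t")
    case True
    then show ?thesis
      using s by (intro exI[of _ s] exI[of _ t]) (auto simp: dist_real_def)
  next
    case False
    then show ?thesis
      using s by (intro exI[of _ t] exI[of _ s]) (auto simp: dist_real_def dist_commute)
  qed
qed

text \<open>Two nested Vitali coverings. The first one uses intervals on which \<open>\<beta>\<close> moves by less than
  \<open>p\<close> times their length; avoiding a nearly optimal partition \<open>xs\<close>, they carry arc length at most
  \<open>p |E| + \<epsilon>\<close>. The second one, inside the first, uses intervals on which \<open>\<beta>\<close> moves by more than
  \<open>q\<close> times their length, so the same arc length is at least \<open>q |E| - \<epsilon>\<close>.\<close>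

lemma negligible_oscillating_quotients:
  fixes \<beta> :: "real \<Rightarrow> 'a::metric_space" and G :: "real \<Rightarrow> real"
  assumes dom: "\<And>s t. a \<le> s \<Longrightarrow> s \<le> t \<Longrightarrow> t \<le> b \<Longrightarrow> dist (\<beta> s) (\<beta> t) \<le> G t - G s"
    and E: "E \<in> lmeasurable" "E \<subseteq> {a<..<b}" and pq: "0 \<le> p" "p < q"
    and lo: "\<And>t. t \<in> E \<Longrightarrow> \<exists>\<^sub>F s in at t. dist (\<beta> s) (\<beta> t) < p * \<bar>s - t\<bar>"
    and hi: "\<And>t. t \<in> E \<Longrightarrow> \<exists>\<^sub>F s in at t. dist (\<beta> s) (\<beta> t) > q * \<bar>s - t\<bar>"
  shows "negligible E"
proof (cases "a \<le> b")
  case False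
  then have "E = {}" using E(2) by fastforce
  then show ?thesis by simp
next
  case True
  obtain L where
    L: "\<And>s t. a \<le> s \<Longrightarrow> s \<le> t \<Longrightarrow> t \<le> b \<Longrightarrow> dist (\<beta> s) (\<beta> t) \<le> L t - L s"
    and near: "\<And>\<epsilon>. \<epsilon> > 0 \<Longrightarrow> \<exists>xs. sorted (a # xs @ [b]) \<and>
        chain_sum (\<lambda>s t. L t - L s - dist (\<beta> s) (\<beta> t)) (a # xs @ [b]) < \<epsilon>"
    using length_function_exists[of a b \<beta> G, OF True dom] by blast
  have L_mono: "L s \<le> L t" if "a \<le> s" "s \<le> t" "t \<le> b" for s t
    using L[OF that] zero_le_dist[of "\<beta> s" "\<beta> t"] by linarith
  define m where "m = measure lebesgue E"
  \<comment> \<open>Letting \<epsilon> tend to 0 leaves q * m \<le> p * m. On the left each of the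
    two coverings loses \<epsilon> of measure; on the right the first \<epsilon> is the excess of
    arc length over chords, and the second is the measure of U outside E.\<close>
  have key: "q * (m - 2 * \<epsilon>) \<le> \<epsilon> + p * (m + \<epsilon>)" if "\<epsilon> > 0" for \<epsilon>
  proof -
    define e where "e = (\<lambda>s t. L t - L s - dist (\<beta> s) (\<beta> t))"
    obtain xs where xs: "sorted (a # xs @ [b])" "chain_sum e (a # xs @ [b]) < \<epsilon>"
      using near[OF \<open>\<epsilon> > 0\<close>] unfolding e_def by blast
    obtain U where U: "open U" "E \<subseteq> U" "U - E \<in> lmeasurable" "emeasure lebesgue (U - E) < ennreal \<epsilon>"
      using sets_lebesgue_outer_open[OF fmeasurableD[OF E(1)] \<open>\<epsilon> > 0\<close>] by blast
    have U_eq: "U = E \<union> (U - E)" using U by blast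
    have Um: "U \<in> lmeasurable" using fmeasurable.Un[OF E(1) U(3)] U_eq by simp
    have "measure lebesgue (U - E) < \<epsilon>"
      using U(3,4) \<open>\<epsilon> > 0\<close> by (simp add: emeasure_eq_measure2 ennreal_less_iff)
    then have Ule: "measure lebesgue U \<le> m + \<epsilon>"
      using measure_Un_le[of E lebesgue "U - E"] E(1) U(3) U_eq by (auto simp: m_def)
    define E' where "E' = E - set xs"
    have E'm: "E' \<in> lmeasurable" unfolding E'_def
      by (intro fmeasurable.Diff E fmeasurableI_null_sets finite_imp_null_set_lborel null_sets_completionI) auto
    have mE': "measure lebesgue E' = m" unfolding m_def
    proof (rule measure_negligible_symdiff[OF E(1)])
      show "negligible (E - E' \<union> (E' - E))"
        by (rule negligible_subset[OF negligible_finite[of "set xs"]]) (auto simp: E'_def)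
    qed
    \<comment> \<open>A closed interval inside W contains no partition point, hence lies in a single
      cell, and its length is charged to U.\<close>
    define W where "W = U \<inter> {a<..<b} - set xs"
    have "open W" unfolding W_def using U(1) by (intro open_Diff open_Int finite_imp_closed) auto
    have E'W: "E' \<subseteq> W" using U(2) E(2) by (auto simp: W_def E'_def)
    define R1 where "R1 = (\<lambda>u v. {u..v} \<subseteq> W \<and> dist (\<beta> u) (\<beta> v) < p * (v - u))"
    obtain F1 where F1: "finite F1" "nonoverlapping F1" "\<And>r. r \<in> F1 \<Longrightarrow> R1 (fst r) (snd r)"
      "measure lebesgue E' - \<epsilon> < measure lebesgue (E' \<inter> (\<Union>r\<in>F1. {fst r<..<snd r}))"
    proof (rule Vitali_finite_intervals[OF E'm \<open>\<epsilon> > 0\<close>])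
      fix t \<eta> :: real assume t: "t \<in> E'" "\<eta> > 0"
      obtain \<rho> where \<rho>: "\<rho> > 0" "ball t \<rho> \<subseteq> W"
        using \<open>open W\<close> E'W t(1) open_contains_ball by blast
      have "\<exists>u v. u < v \<and> u \<le> t \<and> t \<le> v \<and> v - u < min \<eta> \<rho> \<and> dist (\<beta> u) (\<beta> v) < p * (v - u)"
        by (rule frequently_at_interval[where Q = "\<lambda>x y. x < p * y"])
          (use t \<rho> lo in \<open>auto simp: E'_def\<close>)
      then obtain u v where uv: "u < v" "u \<le> t" "t \<le> v" "v - u < \<eta>" "v - u < \<rho>"
        "dist (\<beta> u) (\<beta> v) < p * (v - u)" by auto
      have "{u..v} \<subseteq> ball t \<rho>" using uv by (auto simp: dist_real_def)
      then show "\<exists>u v. u < v \<and> u \<le> t \<and> t \<le> v \<and> v - u < \<eta> \<and> R1 u v"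
        using uv \<rho> unfolding R1_def by blast
    qed blast
    define S2 where "S2 = E' \<inter> (\<Union>r\<in>F1. {fst r<..<snd r})"
    have S2m: "S2 \<in> lmeasurable" unfolding S2_def
      using nonoverlapping_union_measure[OF F1(1,2)] E'm by (intro fmeasurable.Int) auto
    define R2 where "R2 = (\<lambda>u v. q * (v - u) < dist (\<beta> u) (\<beta> v) \<and> (\<exists>r\<in>F1. fst r \<le> u \<and> v \<le> snd r))"
    obtain F2 where F2: "finite F2" "nonoverlapping F2" "\<And>r. r \<in> F2 \<Longrightarrow> R2 (fst r) (snd r)"
      "measure lebesgue S2 - \<epsilon> < measure lebesgue (S2 \<inter> (\<Union>r\<in>F2. {fst r<..<snd r}))"
    proof (rule Vitali_finite_intervals[OF S2m \<open>\<epsilon> > 0\<close>])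
      fix t \<eta> :: real assume t: "t \<in> S2" "\<eta> > 0"
      obtain r where r: "r \<in> F1" "fst r < t" "t < snd r" using t(1) by (auto simp: S2_def)
      have "\<exists>u v. u < v \<and> u \<le> t \<and> t \<le> v \<and> v - u < min \<eta> (min (t - fst r) (snd r - t))
          \<and> q * (v - u) < dist (\<beta> u) (\<beta> v)"
        by (rule frequently_at_interval[where Q = "\<lambda>x y. q * y < x"])
          (use t r hi in \<open>auto simp: E'_def S2_def\<close>)
      then obtain u v where uv: "u < v" "u \<le> t" "t \<le> v" "v - u < \<eta>" "v - u < t - fst r"
        "v - u < snd r - t" "q * (v - u) < dist (\<beta> u) (\<beta> v)" by auto
      then have "R2 u v" unfolding R2_def using r by (auto intro!: bexI[of _ r])
      then show "\<exists>u v. u < v \<and> u \<le> t \<and> t \<le> v \<and> v - u < \<eta> \<and> R2 u v"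
        using uv by blast
    qed blast
    have lt1: "fst r < snd r" if "r \<in> F1" for r using F1(2) that by (simp add: nonoverlapping_def)
    have lt2: "fst r < snd r" if "r \<in> F2" for r using F2(2) that by (simp add: nonoverlapping_def)
    have W1: "{fst r..snd r} \<subseteq> W" if "r \<in> F1" for r using F1(3)[OF that] by (simp add: R1_def)
    have ab1: "a < fst r" "snd r < b" if "r \<in> F1" for r
      using W1[OF that] lt1[OF that] by (auto simp: W_def subset_iff)
    have len2: "m - 2 * \<epsilon> \<le> (\<Sum>r\<in>F2. snd r - fst r)"
    proof -
      have "measure lebesgue (S2 \<inter> (\<Union>r\<in>F2. {fst r<..<snd r}))
          \<le> measure lebesgue (\<Union>r\<in>F2. {fst r<..<snd r})"
        using nonoverlapping_union_measure(1)[OF F2(1,2)] S2m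
        by (intro measure_mono_fmeasurable) (auto intro!: sets.Int fmeasurableD)
      then show ?thesis
        using F1(4) F2(4) mE' nonoverlapping_union_measure(2)[OF F2(1,2)]
        unfolding S2_def by linarith
    qed
    obtain h where h: "\<And>r. r \<in> F2 \<Longrightarrow> h r \<in> F1 \<and> fst (h r) \<le> fst r \<and> snd r \<le> snd (h r)"
      using F2(3) unfolding R2_def by metis
    have "q * (m - 2 * \<epsilon>) \<le> q * (\<Sum>r\<in>F2. snd r - fst r)"
      using len2 pq by (intro mult_left_mono) auto
    also have "\<dots> = (\<Sum>r\<in>F2. q * (snd r - fst r))" by (simp add: sum_distrib_left)
    also have "\<dots> \<le> (\<Sum>r\<in>F2. L (snd r) - L (fst r))"
    proof (rule sum_mono)
      fix r assume r: "r \<in> F2"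
      have "q * (snd r - fst r) \<le> dist (\<beta> (fst r)) (\<beta> (snd r))"
        using F2(3)[OF r] by (simp add: R2_def)
      also have "\<dots> \<le> L (snd r) - L (fst r)"
        using h[OF r] ab1[of "h r"] lt2[OF r] by (intro L) auto
      finally show "q * (snd r - fst r) \<le> L (snd r) - L (fst r)" .
    qed
    \<comment> \<open>The small intervals are grouped by the member \<open>h\<close> of F1 that
      contains them. Within one such member, monotonicity of L bounds the sum of their increments by
      its own increment.\<close>
    also have "\<dots> = (\<Sum>r\<in>F1. \<Sum>x\<in>{x\<in>F2. h x = r}. L (snd x) - L (fst x))"
      by (rule sum.group[symmetric]) (use F1(1) F2(1) h in auto)
    also have "\<dots> \<le> (\<Sum>r\<in>F1. L (snd r) - L (fst r))"
    proof (rule sum_mono)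
      fix r assume r: "r \<in> F1"
      show "(\<Sum>x\<in>{x\<in>F2. h x = r}. L (snd x) - L (fst x)) \<le> L (snd r) - L (fst r)"
        by (rule sum_superadditive_le[where c = a and d = b and e = "\<lambda>u v. L v - L u"])
          (use F2 h r ab1[OF r] lt1[OF r] L_mono in \<open>auto intro: nonoverlapping_subset\<close>)
    qed
    also have "\<dots> = (\<Sum>r\<in>F1. e (fst r) (snd r)) + (\<Sum>r\<in>F1. dist (\<beta> (fst r)) (\<beta> (snd r)))"
      by (simp add: e_def sum.distrib[symmetric])
    also have "\<dots> \<le> \<epsilon> + p * (\<Sum>r\<in>F1. snd r - fst r)"
    proof (rule add_mono)
      have "(\<Sum>r\<in>F1. e (fst r) (snd r)) \<le> chain_sum e (a # xs @ [b])"
      proof (rule sum_le_chain_sum[where c = a and d = b])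
        show "e x y + e y z \<le> e x z" for x y z
          using dist_triangle[of "\<beta> x" "\<beta> z" "\<beta> y"] by (simp add: e_def)
        show "0 \<le> e x y" if "a \<le> x" "x \<le> y" "y \<le> b" for x y
          using L[OF that] by (simp add: e_def)
        show "a \<le> fst r \<and> snd r \<le> last (a # xs @ [b])" if "r \<in> F1" for r
          using ab1[OF that] by simp
        show "z \<le> fst r \<or> snd r \<le> z" if "r \<in> F1" "z \<in> set (xs @ [b])" for r z
        proof (rule ccontr)
          assume "\<not> ?thesis"
          then have "z \<in> {fst r..snd r}" by auto
          then have "z \<in> W" using W1[OF that(1)] by blast
          then show False using that(2) by (auto simp: W_def)
        qed
        show "set (a # xs @ [b]) \<subseteq> {a..b}" using xs(1) by (auto simp: sorted_append)
      qed (use F1 xs in auto)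
      then show "(\<Sum>r\<in>F1. e (fst r) (snd r)) \<le> \<epsilon>" using xs(2) by linarith
      show "(\<Sum>r\<in>F1. dist (\<beta> (fst r)) (\<beta> (snd r))) \<le> p * (\<Sum>r\<in>F1. snd r - fst r)"
        unfolding sum_distrib_left
        by (rule sum_mono) (use F1(3) in \<open>auto simp: R1_def less_imp_le\<close>)
    qed
    also have "(\<Sum>r\<in>F1. snd r - fst r) \<le> measure lebesgue U"
    proof (rule nonoverlapping_sum_le_measure[OF F1(1,2) _ Um])
      show "(\<Union>r\<in>F1. {fst r<..<snd r}) \<subseteq> U"
      proof (rule UN_least)
        fix r assume "r \<in> F1"
        have "{fst r<..<snd r} \<subseteq> {fst r..snd r}" by auto
        also have "\<dots> \<subseteq> U" using W1[OF \<open>r \<in> F1\<close>] by (auto simp: W_def)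
        finally show "{fst r<..<snd r} \<subseteq> U" .
      qed
    qed
    also note Ule
    finally show ?thesis using pq by (simp add: mult_left_mono)
  qed
  have "m = 0"
  proof (rule ccontr)
    assume "m \<noteq> 0"
    then have "m > 0" by (simp add: m_def zero_less_measure_iff)
    \<comment> \<open>With this choice \<epsilon> * (1 + p + 2 * q) is half of (q - p) * m, whereas
      \<open>key\<close> rearranges to its being at least (q - p) * m.\<close>
    define \<epsilon> where "\<epsilon> = (q - p) * m / (2 * (1 + p + 2 * q))"
    have "\<epsilon> > 0" using pq \<open>m > 0\<close> by (simp add: \<epsilon>_def)
    have "\<epsilon> * (1 + p + 2 * q) = (q - p) * m / 2"
      using pq by (simp add: \<epsilon>_def field_simps)
    moreover have "(q - p) * m \<le> \<epsilon> * (1 + p + 2 * q)"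
      using key[OF \<open>\<epsilon> > 0\<close>] by (simp add: algebra_simps)
    moreover have "(q - p) * m > 0" using pq \<open>m > 0\<close> by simp
    ultimately show False by linarith
  qed
  then show ?thesis using E(1) by (simp add: m_def negligible_iff_measure)
qed

text \<open>Frequently near t means that for every k some s closer to t than 1 / (k + 1) satisfies
  Q. Each of these conditions on t is open, as a union of open sets over arbitrarily many s, so
  countably many of them cut out a Borel set.\<close>

lemma borel_frequently_at:
  fixes A :: "'b::metric_space set"
  assumes "open A" "\<And>s. s \<in> A \<Longrightarrow> open {t\<in>A. Q s t}"
  shows "{t\<in>A. \<exists>\<^sub>F s in at t. Q s t} \<in> sets borel"
proof -
  define V where "V = (\<lambda>k::nat. \<Union>s\<in>A. {t\<in>A. Q s t} \<inter> (ball s (inverse (real (Suc k))) - {s}))"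
  have V: "open (V k)" for k
    unfolding V_def using assms by (intro open_UN ballI open_Int open_Diff) auto
  have "(\<exists>\<^sub>F s in at t. Q s t) \<longleftrightarrow> (\<forall>k. t \<in> V k)" if t: "t \<in> A" for t
  proof
    assume *: "\<exists>\<^sub>F s in at t. Q s t"
    show "\<forall>k. t \<in> V k"
    proof
      fix k
      have "\<exists>\<^sub>F s in at t within A. Q s t" using * at_within_open[OF t \<open>open A\<close>] by simp
      then obtain s where "s \<in> A" "s \<noteq> t" "dist s t < inverse (real (Suc k))" "Q s t"
        unfolding frequently_at by (metis inverse_positive_iff_positive of_nat_0_less_iff zero_less_Suc)
      then show "t \<in> V k" using t unfolding V_def by auto
    qed
  next
    assume V: "\<forall>k. t \<in> V k"
    show "\<exists>\<^sub>F s in at t. Q s t"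
      unfolding frequently_at
    proof (intro allI impI)
      fix d :: real assume "d > 0"
      then obtain k where k: "inverse (real (Suc k)) < d" using reals_Archimedean by blast
      obtain s where "s \<in> A" "Q s t" "dist s t < inverse (real (Suc k))" "s \<noteq> t"
        using V[rule_format, of k] unfolding V_def by auto
      then show "\<exists>s\<in>UNIV. s \<noteq> t \<and> dist s t < d \<and> Q s t" using k by force
    qed
  qed
  then have "{t\<in>A. \<exists>\<^sub>F s in at t. Q s t} = A \<inter> (\<Inter>k. V k)" by blast
  also have "\<dots> \<in> sets borel" using V \<open>open A\<close> by (intro sets.Int sets.countable_INT) auto
  finally show ?thesis .
qed

text \<open>For fixed p < q the exceptional set is Borel by continuity of \<beta> and null by the
  nested coverings. Rational p and q leave only countably many such sets to unite.\<close>

lemma AE_no_oscillation: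
  fixes \<beta> :: "real \<Rightarrow> 'a::metric_space" and G :: "real \<Rightarrow> real"
  assumes dom: "\<And>s t. a \<le> s \<Longrightarrow> s \<le> t \<Longrightarrow> t \<le> b \<Longrightarrow> dist (\<beta> s) (\<beta> t) \<le> G t - G s"
    and cont: "continuous_on {a<..<b} \<beta>"
  shows "AE t in lebesgue. t \<in> {a<..<b} \<longrightarrow> (\<forall>p\<in>\<rat>. \<forall>q\<in>\<rat>. 0 \<le> p \<longrightarrow> p < q \<longrightarrow>
           \<not> ((\<exists>\<^sub>F s in at t. dist (\<beta> s) (\<beta> t) < p * \<bar>s - t\<bar>) \<and>
              (\<exists>\<^sub>F s in at t. dist (\<beta> s) (\<beta> t) > q * \<bar>s - t\<bar>)))"
proof -
  define A where "A = {a<..<b}"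
  define lo where "lo = (\<lambda>p. {t\<in>A. \<exists>\<^sub>F s in at t. dist (\<beta> s) (\<beta> t) < p * \<bar>s - t\<bar>})"
  define hi where "hi = (\<lambda>q. {t\<in>A. \<exists>\<^sub>F s in at t. dist (\<beta> s) (\<beta> t) > q * \<bar>s - t\<bar>})"
  have opn: "open {t\<in>A. 0 < g t}" if "continuous_on A g" for g :: "real \<Rightarrow> real"
  proof -
    have "open (A \<inter> g -` {0<..})"
      using that by (intro continuous_open_preimage) (auto simp: A_def)
    also have "A \<inter> g -` {0<..} = {t\<in>A. 0 < g t}" by auto
    finally show ?thesis .
  qed
  have c: "continuous_on A \<beta>" using cont by (simp add: A_def)
  have lo: "lo p \<in> sets borel" for p
    unfolding lo_def
  proof (rule borel_frequently_at)
    show "open {t\<in>A. dist (\<beta> s) (\<beta> t) < p * \<bar>s - t\<bar>}" for s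
    proof -
      have "continuous_on A (\<lambda>t. p * \<bar>s - t\<bar> - dist (\<beta> s) (\<beta> t))"
        by (intro continuous_intros c)
      from opn[OF this] show ?thesis by simp
    qed
  qed (simp add: A_def)
  have hi: "hi p \<in> sets borel" for p
    unfolding hi_def
  proof (rule borel_frequently_at)
    show "open {t\<in>A. dist (\<beta> s) (\<beta> t) > p * \<bar>s - t\<bar>}" for s
    proof -
      have "continuous_on A (\<lambda>t. dist (\<beta> s) (\<beta> t) - p * \<bar>s - t\<bar>)"
        by (intro continuous_intros c)
      from opn[OF this] show ?thesis by simp
    qed
  qed (simp add: A_def)
  have neg: "negligible (lo p \<inter> hi q)" if "0 \<le> p" "p < q" for p q
  proof (rule negligible_oscillating_quotients[where a = a and b = b, OF dom _ _ that])
    have "lo p \<inter> hi q \<in> sets lebesgue" using lo[of p] hi[of q] by auto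
    moreover have "lo p \<inter> hi q \<subseteq> {a..b}" by (auto simp: lo_def A_def)
    ultimately show "lo p \<inter> hi q \<in> lmeasurable"
      using bounded_set_imp_lmeasurable bounded_subset[OF bounded_closed_interval] by blast
  qed (auto simp: lo_def hi_def A_def)
  define C where "C = {pq \<in> \<rat> \<times> \<rat>. 0 \<le> fst pq \<and> fst pq < (snd pq :: real)}"
  have "countable C" unfolding C_def
    by (rule countable_subset[of _ "\<rat> \<times> \<rat>"]) (auto simp: countable_rat)
  then have "negligible (\<Union>pq\<in>C. lo (fst pq) \<inter> hi (snd pq))"
    by (intro negligible_countable_Union) (auto simp: C_def intro!: neg)
  then show ?thesis
    unfolding negligible_iff_null_sets
    by (rule AE_I'[where N = "\<Union>pq\<in>C. lo (fst pq) \<inter> hi (snd pq)"])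
      (force simp: C_def lo_def hi_def A_def)
qed

text \<open>The limit is the lower limit of h, which is \<open>Sup P\<close>; the bounds on h make P
  nonempty and bounded above. A rational p just above it is undercut frequently, so no rational q >
  p can be exceeded frequently, and the upper limit is no larger.\<close>

lemma tendsto_if_no_oscillation:
  fixes h :: "'b \<Rightarrow> real"
  assumes "F \<noteq> bot" and bdd: "eventually (\<lambda>s. 0 \<le> h s \<and> h s \<le> B) F"
    and osc: "\<And>p q. p \<in> \<rat> \<Longrightarrow> q \<in> \<rat> \<Longrightarrow> 0 \<le> p \<Longrightarrow> p < q \<Longrightarrow>
      \<not> ((\<exists>\<^sub>F s in F. h s < p) \<and> (\<exists>\<^sub>F s in F. h s > q))"
  shows "\<exists>v. (h \<longlongrightarrow> v) F"
proof -
  define P where "P = {p. eventually (\<lambda>s. p \<le> h s) F}"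
  have P0: "0 \<in> P" using bdd by (auto simp: P_def elim: eventually_mono)
  have "p \<le> B" if "p \<in> P" for p
  proof -
    have "eventually (\<lambda>s. p \<le> B) F"
      using that bdd unfolding P_def mem_Collect_eq by eventually_elim auto
    then show ?thesis using \<open>F \<noteq> bot\<close> by (simp add: eventually_const_iff)
  qed
  then have BP: "bdd_above P" by (rule bdd_aboveI)
  have "(h \<longlongrightarrow> Sup P) F"
  proof (rule order_tendstoI)
    fix y assume "y < Sup P"
    then obtain p where "p \<in> P" "y < p" using less_cSup_iff[OF _ BP] P0 by blast
    then show "eventually (\<lambda>s. y < h s) F" by (auto simp: P_def elim: eventually_mono)
  next
    fix y assume y: "Sup P < y"
    obtain p where p: "p \<in> \<rat>" "Sup P < p" "p < y" using Rats_dense_in_real[OF y] by blast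
    obtain q where q: "q \<in> \<rat>" "p < q" "q < y" using Rats_dense_in_real[OF p(3)] by blast
    have "p \<notin> P" using p(2) cSup_upper[OF _ BP] by force
    then have "\<exists>\<^sub>F s in F. h s < p" by (simp add: P_def not_eventually not_le)
    moreover have "0 \<le> p" using cSup_upper[OF P0 BP] p(2) by simp
    ultimately have "\<not> (\<exists>\<^sub>F s in F. h s > q)" using osc p q by blast
    then show "eventually (\<lambda>s. h s < y) F"
      using q(3) by (auto simp: not_frequently elim: eventually_mono)
  qed
  then show ?thesis by blast
qed

section \<open>Integrating a local bound along an absolutely continuous curve\<close>

text \<open>Tagged divisions produce sets of intervals without an order, whereas the definition
  takes indexed families; a bijection with an initial segment of the naturals translates between the
  two.\<close>

lemma abs_cont_curve_finite:
  assumes "abs_cont_curve a b \<alpha> \<beta>" "\<epsilon> > 0"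
  obtains \<delta> where "\<delta> > 0"
    "\<And>F. finite F \<Longrightarrow> nonoverlapping F \<Longrightarrow> (\<And>p. p \<in> F \<Longrightarrow> a \<le> fst p \<and> snd p \<le> b) \<Longrightarrow>
       (\<Sum>p\<in>F. snd p - fst p) < \<delta> \<Longrightarrow>
       (\<Sum>p\<in>F. Dmet (\<alpha> (fst p), \<beta> (fst p)) (\<alpha> (snd p), \<beta> (snd p))) < \<epsilon>"
proof -
  obtain \<delta> where *: "\<delta> > 0 \<and> (\<forall>(n::nat) u v.
        (\<forall>i<n. a \<le> u i \<and> u i \<le> v i \<and> v i \<le> b) \<and>
        (\<forall>i<n. \<forall>j<n. i \<noteq> j \<longrightarrow> v i \<le> u j \<or> v j \<le> u i) \<and>
        (\<Sum>i<n. v i - u i) < \<delta>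
        \<longrightarrow> (\<Sum>i<n. Dmet (\<alpha> (u i), \<beta> (u i)) (\<alpha> (v i), \<beta> (v i))) < \<epsilon>)"
    using assms(1)[unfolded abs_cont_curve_def, rule_format, OF assms(2)] ..
  note \<delta> = conjunct2[OF this, rule_format, OF conjI, OF _ conjI]
  have "\<delta> > 0" using * ..
  show thesis
  proof (rule that[OF \<open>\<delta> > 0\<close>])
    fix F assume F: "finite F" "nonoverlapping F" "\<And>p. p \<in> F \<Longrightarrow> a \<le> fst p \<and> snd p \<le> b"
       "(\<Sum>p\<in>F. snd p - fst p) < \<delta>"
    obtain h where h: "bij_betw h {..<card F} F"
      using ex_bij_betw_nat_finite[OF F(1)] by (auto simp: atLeast0LessThan)
    have sum_eq: "(\<Sum>i<card F. g (h i)) = (\<Sum>p\<in>F. g p)" for g :: "real \<times> real \<Rightarrow> real"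
      by (rule sum.reindex_bij_betw[OF h])
    have hF: "h i \<in> F" if "i < card F" for i using h that by (auto simp: bij_betw_def)
    have inj: "h i \<noteq> h j" if "i < card F" "j < card F" "i \<noteq> j" for i j
      using h that by (auto simp: bij_betw_def inj_on_def)
    have "(\<Sum>i<card F. Dmet (\<alpha> (fst (h i)), \<beta> (fst (h i))) (\<alpha> (snd (h i)), \<beta> (snd (h i)))) < \<epsilon>"
    proof (rule \<delta>)
      show "\<forall>i<card F. a \<le> fst (h i) \<and> fst (h i) \<le> snd (h i) \<and> snd (h i) \<le> b"
        using F(2,3) hF by (auto simp: nonoverlapping_def less_imp_le)
      show "\<forall>i<card F. \<forall>j<card F. i \<noteq> j \<longrightarrow>
          snd (h i) \<le> fst (h j) \<or> snd (h j) \<le> fst (h i)"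
        using F(2) hF inj by (simp add: nonoverlapping_def pairwise_def)
      show "(\<Sum>i<card F. snd (h i) - fst (h i)) < \<delta>"
        using F(4) sum_eq[of "\<lambda>p. snd p - fst p"] by simp
    qed
    then show "(\<Sum>p\<in>F. Dmet (\<alpha> (fst p), \<beta> (fst p)) (\<alpha> (snd p), \<beta> (snd p))) < \<epsilon>"
      using sum_eq[of "\<lambda>p. Dmet (\<alpha> (fst p), \<beta> (fst p)) (\<alpha> (snd p), \<beta> (snd p))"] by simp
  qed
qed

lemma Dmet_ge_dist: "dist x y \<le> Dmet (s, x) (t, y)"
  by (simp add: Dmet_def)

lemma abs_cont_curve_continuous:
  assumes ac: "abs_cont_curve a b \<alpha> \<beta>"
  shows "continuous_on {a..b} \<beta>"
  unfolding continuous_on_iff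
proof (intro ballI allI impI)
  fix x \<epsilon> :: real assume x: "x \<in> {a..b}" and "\<epsilon> > 0"
  obtain \<delta> where "\<delta> > 0" and
    \<delta>: "\<And>F. finite F \<Longrightarrow> nonoverlapping F \<Longrightarrow> (\<And>p. p \<in> F \<Longrightarrow> a \<le> fst p \<and> snd p \<le> b) \<Longrightarrow>
       (\<Sum>p\<in>F. snd p - fst p) < \<delta> \<Longrightarrow>
       (\<Sum>p\<in>F. Dmet (\<alpha> (fst p), \<beta> (fst p)) (\<alpha> (snd p), \<beta> (snd p))) < \<epsilon>"
    using abs_cont_curve_finite[OF ac \<open>\<epsilon> > 0\<close>] by blast
  have D: "dist (\<beta> u) (\<beta> v) < \<epsilon>" if "a \<le> u" "u < v" "v \<le> b" "v - u < \<delta>" for u v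
  proof -
    have "Dmet (\<alpha> u, \<beta> u) (\<alpha> v, \<beta> v) < \<epsilon>"
      using \<delta>[of "{(u, v)}"] that by (auto simp: nonoverlapping_def)
    then show ?thesis using Dmet_ge_dist order_le_less_trans by blast
  qed
  show "\<exists>d>0. \<forall>x'\<in>{a..b}. dist x' x < d \<longrightarrow> dist (\<beta> x') (\<beta> x) < \<epsilon>"
  proof (intro exI[of _ \<delta>] conjI ballI impI \<open>\<delta> > 0\<close>)
    fix y assume "y \<in> {a..b}" "dist y x < \<delta>"
    then show "dist (\<beta> y) (\<beta> x) < \<epsilon>"
      using D[of x y] D[of y x] x \<open>\<epsilon> > 0\<close>
      by (cases x y rule: linorder_cases) (auto simp: dist_real_def dist_commute)
  qed
qed

text \<open>A gauge that is the local bound off an exceptional null set \<open>N\<close> and a small open neighbourhood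
  of \<open>N\<close> on it: absolute continuity makes the intervals tagged in \<open>N\<close> negligible. The triangle
  inequality over the division is replaced by telescoping \<open>x \<mapsto> dist (\<beta> c) (\<beta> x)\<close>.\<close>

lemma dist_le_of_AE_local_bound:
  fixes \<beta> :: "real \<Rightarrow> 'a::metric_space" and G :: "real \<Rightarrow> real"
  assumes ac: "abs_cont_curve a b \<alpha> \<beta>" and cd: "a \<le> c" "c \<le> d" "d \<le> b"
    and mono: "\<And>s t. c \<le> s \<Longrightarrow> s \<le> t \<Longrightarrow> t \<le> d \<Longrightarrow> G s \<le> G t"
    and loc: "AE x in lebesgue. x \<in> {c..d} \<longrightarrow> (\<forall>\<epsilon>>0. \<forall>\<^sub>F y in at x within {c..d}.
        dist (\<beta> y) (\<beta> x) \<le> \<bar>G y - G x\<bar> + \<epsilon> * \<bar>y - x\<bar>)"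
  shows "dist (\<beta> c) (\<beta> d) \<le> G d - G c"
proof -
  define \<phi> where "\<phi> = (\<lambda>x. dist (\<beta> c) (\<beta> x))"
  \<comment> \<open>The term \<epsilon> * (d - c) collects the errors at tags outside the null set,
    the last \<epsilon> those at tags inside it.\<close>
  have "\<phi> d - \<phi> c \<le> (G d - G c) + \<epsilon> * (d - c) + \<epsilon>" if "\<epsilon> > 0" for \<epsilon>
  proof -
    obtain \<delta> where "\<delta> > 0" and
      \<delta>: "\<And>F. finite F \<Longrightarrow> nonoverlapping F \<Longrightarrow> (\<And>p. p \<in> F \<Longrightarrow> a \<le> fst p \<and> snd p \<le> b) \<Longrightarrow>
       (\<Sum>p\<in>F. snd p - fst p) < \<delta> \<Longrightarrow>
       (\<Sum>p\<in>F. Dmet (\<alpha> (fst p), \<beta> (fst p)) (\<alpha> (snd p), \<beta> (snd p))) < \<epsilon>"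
      using abs_cont_curve_finite[OF ac \<open>\<epsilon> > 0\<close>] by blast
    obtain N where N: "N \<in> null_sets lebesgue"
      and N_good: "\<And>x. x \<in> space lebesgue - N \<Longrightarrow> x \<in> {c..d} \<longrightarrow> (\<forall>\<epsilon>>0.
        \<forall>\<^sub>F y in at x within {c..d}. dist (\<beta> y) (\<beta> x) \<le> \<bar>G y - G x\<bar> + \<epsilon> * \<bar>y - x\<bar>)"
      using AE_E3[OF loc] by blast
    have good: "\<forall>\<^sub>F y in at x within {c..d}. dist (\<beta> y) (\<beta> x) \<le> \<bar>G y - G x\<bar> + \<epsilon> * \<bar>y - x\<bar>"
      if "x \<in> {c..d}" "x \<notin> N" for x
      using N_good[of x] that \<open>\<epsilon> > 0\<close> by simp
    obtain U where U: "open U" "N \<subseteq> U" "U - N \<in> lmeasurable" "emeasure lebesgue (U - N) < ennreal \<delta>"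
      using sets_lebesgue_outer_open[OF null_setsD2[OF N] \<open>\<delta> > 0\<close>] by blast
    have "emeasure lebesgue U = emeasure lebesgue (U - N)"
      using U N by (simp add: emeasure_Diff_null_set borel_open)
    then have eU: "emeasure lebesgue U < ennreal \<delta>" using U(4) by simp
    have Um: "U \<in> lmeasurable"
      using U(1) less_trans[OF eU ennreal_less_top]
      by (intro fmeasurableI) (auto simp: borel_open)
    have "measure lebesgue U < \<delta>"
      using eU Um \<open>\<delta> > 0\<close> by (simp add: emeasure_eq_measure2 ennreal_less_iff)
    have "\<exists>r>0. x \<in> {c..d} - N \<longrightarrow> (\<forall>y\<in>{c..d}. dist y x < r \<longrightarrow>
        dist (\<beta> y) (\<beta> x) \<le> \<bar>G y - G x\<bar> + \<epsilon> * \<bar>y - x\<bar>)" for x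
    proof (cases "x \<in> {c..d} - N")
      case True
      then obtain r where "r > 0" and
        r: "\<And>y. y \<in> {c..d} \<Longrightarrow> y \<noteq> x \<Longrightarrow> dist y x < r \<Longrightarrow>
          dist (\<beta> y) (\<beta> x) \<le> \<bar>G y - G x\<bar> + \<epsilon> * \<bar>y - x\<bar>"
        using good[of x] unfolding eventually_at by auto
      have "dist (\<beta> y) (\<beta> x) \<le> \<bar>G y - G x\<bar> + \<epsilon> * \<bar>y - x\<bar>"
        if "y \<in> {c..d}" "dist y x < r" for y
        using r[OF that(1) _ that(2)] by (cases "y = x") auto
      then show ?thesis using \<open>r > 0\<close> by blast
    qed (auto intro: exI[of _ 1])
    then obtain r where r0: "\<And>x. r x > 0" and
      r: "\<And>x y. x \<in> {c..d} - N \<Longrightarrow> y \<in> {c..d} \<Longrightarrow> dist y x < r x \<Longrightarrow>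
        dist (\<beta> y) (\<beta> x) \<le> \<bar>G y - G x\<bar> + \<epsilon> * \<bar>y - x\<bar>"
      by metis
    define \<gamma> where "\<gamma> = (\<lambda>x. if x \<in> N then U else ball x (r x))"
    have "gauge \<gamma>" unfolding gauge_def \<gamma>_def using U r0 by auto
    then obtain T where T: "T tagged_division_of {c..d}" "\<gamma> fine T"
      by (rule fine_division_exists_real)
    have tag: "\<exists>u v. K = {u..v} \<and> u \<le> x \<and> x \<le> v \<and> c \<le> u \<and> v \<le> d \<and> {u..v} \<subseteq> \<gamma> x"
      if xK: "(x, K) \<in> T" for x K
    proof -
      obtain u v where "K = cbox u v" using T(1) xK by blast
      moreover have "x \<in> K" "K \<subseteq> {c..d}" using T(1) xK by blast+
      moreover have "K \<subseteq> \<gamma> x" using T(2) xK by (auto simp: fine_def)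
      ultimately show ?thesis by (intro exI[of _ u] exI[of _ v]) auto
    qed
    \<comment> \<open>Degenerate intervals contribute nothing. Without them \<open>ends\<close> is
      injective on B, and its image is nonoverlapping.\<close>
    define B where "B = {z\<in>T. fst z \<in> N \<and> Inf (snd z) < Sup (snd z)}"
    define ends where "ends = (\<lambda>z::real \<times> real set. (Inf (snd z), Sup (snd z)))"
    define g where "g = (\<lambda>z::real \<times> real set. dist (\<beta> (Inf (snd z))) (\<beta> (Sup (snd z))))"
    have finT: "finite T" using T(1) by blast
    have fB: "finite B" using finT by (simp add: B_def)
    have pt: "\<phi> (Sup K) - \<phi> (Inf K) \<le> (G (Sup K) - G (Inf K)) + \<epsilon> * (Sup K - Inf K)
        + (if (x, K) \<in> B then g (x, K) else 0)" if xK: "(x, K) \<in> T" for x K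
    proof -
      obtain u v where uv: "K = {u..v}" "u \<le> x" "x \<le> v" "c \<le> u" "v \<le> d" "{u..v} \<subseteq> \<gamma> x"
        using tag[OF xK] by blast
      have K: "Inf K = u" "Sup K = v" using uv by auto
      have G: "G u \<le> G x" "G x \<le> G v" using uv by (auto intro!: mono)
      have \<phi>: "\<phi> v - \<phi> u \<le> dist (\<beta> u) (\<beta> v)"
        using dist_triangle[of "\<beta> c" "\<beta> v" "\<beta> u"] by (simp add: \<phi>_def)
      show ?thesis
      proof (cases "x \<in> N")
        case True
        moreover have "0 \<le> \<epsilon> * (v - u)" using uv \<open>\<epsilon> > 0\<close> by simp
        ultimately show ?thesis
          using \<phi> G uv xK unfolding K g_def B_def by (cases "u = v") (auto simp: K)
      next
        case False
        then have "{u..v} \<subseteq> ball x (r x)" using uv(6) by (simp add: \<gamma>_def)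
        moreover have "u \<in> {u..v}" "v \<in> {u..v}" using uv by auto
        ultimately have "u \<in> ball x (r x)" "v \<in> ball x (r x)" by blast+
        then have "dist (\<beta> u) (\<beta> x) \<le> \<bar>G u - G x\<bar> + \<epsilon> * \<bar>u - x\<bar>"
          "dist (\<beta> v) (\<beta> x) \<le> \<bar>G v - G x\<bar> + \<epsilon> * \<bar>v - x\<bar>"
          using r[of x u] r[of x v] uv False by (auto simp: dist_commute)
        moreover have "dist (\<beta> u) (\<beta> v) \<le> dist (\<beta> u) (\<beta> x) + dist (\<beta> v) (\<beta> x)"
          by (rule dist_triangle2)
        ultimately have "dist (\<beta> u) (\<beta> v) \<le> G v - G u + \<epsilon> * (v - u)"
          using G uv by (simp add: algebra_simps)
        then show ?thesis using \<phi> False unfolding K by (simp add: B_def)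
      qed
    qed
    have nov: "Sup (snd z) \<le> Inf (snd w) \<or> Sup (snd w) \<le> Inf (snd z)"
      if zw: "z \<in> B" "w \<in> B" "z \<noteq> w" for z w
    proof -
      obtain x K y J where e: "z = (x, K)" "w = (y, J)" by (metis surj_pair)
      then have T': "(x, K) \<in> T" "(y, J) \<in> T" using zw by (auto simp: B_def)
      obtain u v u' v' where uv: "K = {u..v}" "u \<le> v" "J = {u'..v'}" "u' \<le> v'"
        using tag[OF T'(1)] tag[OF T'(2)] by force
      have "interior K \<inter> interior J = {}"
        using tagged_division_ofD(5)[OF T(1) T'] zw(3) e by blast
      then have disj: "{u<..<v} \<inter> {u'<..<v'} = {}" by (simp add: uv)
      have lt: "u < v" "u' < v'" using zw e uv by (auto simp: B_def)
      have "v \<le> u' \<or> v' \<le> u"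
      proof (rule ccontr)
        assume "\<not> ?thesis"
        then have "max u u' < min v v'" using lt by auto
        then obtain w where "max u u' < w" "w < min v v'" using dense by blast
        then have "w \<in> {u<..<v} \<inter> {u'<..<v'}" by auto
        then show False using disj by blast
      qed
      then show ?thesis using uv e by simp
    qed
    have inj: "inj_on ends B"
    proof (rule inj_onI, rule ccontr)
      fix z w assume "z \<in> B" "w \<in> B" "ends z = ends w" "z \<noteq> w"
      then show False using nov[of z w] by (auto simp: ends_def B_def)
    qed
    have no: "nonoverlapping (ends ` B)"
      unfolding nonoverlapping_def
    proof (intro conjI ballI pairwiseI)
      show "fst p < snd p" if "p \<in> ends ` B" for p
        using that by (auto simp: ends_def B_def)
      show "snd p \<le> fst q \<or> snd q \<le> fst p"
        if pq: "p \<in> ends ` B" "q \<in> ends ` B" "p \<noteq> q" for p q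
      proof -
        obtain z w where "z \<in> B" "w \<in> B" "p = ends z" "q = ends w"
          using pq(1,2) by blast
        moreover from this have "z \<noteq> w" using pq(3) by blast
        ultimately show ?thesis using nov[of z w] by (simp add: ends_def)
      qed
    qed
    have ie: "a \<le> fst p \<and> snd p \<le> b \<and> {fst p<..<snd p} \<subseteq> U" if p: "p \<in> ends ` B" for p
    proof -
      obtain x K where xK: "(x, K) \<in> T" "x \<in> N" "p = (Inf K, Sup K)"
        using p by (auto simp: B_def ends_def)
      then obtain u v where uv: "K = {u..v}" "u \<le> x" "x \<le> v" "c \<le> u" "v \<le> d" "{u..v} \<subseteq> \<gamma> x"
        using tag by blast
      then have "p = (u, v)" using xK by simp
      then show ?thesis using uv xK cd by (auto simp: \<gamma>_def subset_iff)
    qed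
    have "(\<Sum>p\<in>ends ` B. snd p - fst p) \<le> measure lebesgue U"
    proof (rule nonoverlapping_sum_le_measure[OF _ no _ Um])
      show "(\<Union>p\<in>ends ` B. {fst p<..<snd p}) \<subseteq> U" using ie by blast
    qed (use fB in simp)
    then have "(\<Sum>p\<in>ends ` B. Dmet (\<alpha> (fst p), \<beta> (fst p)) (\<alpha> (snd p), \<beta> (snd p))) < \<epsilon>"
      using \<open>measure lebesgue U < \<delta>\<close> fB ie by (intro \<delta> no) auto
    moreover have "(\<Sum>p\<in>ends ` B. Dmet (\<alpha> (fst p), \<beta> (fst p)) (\<alpha> (snd p), \<beta> (snd p))) \<ge>
        (\<Sum>p\<in>ends ` B. dist (\<beta> (fst p)) (\<beta> (snd p)))"
      by (intro sum_mono Dmet_ge_dist)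
    moreover have "(\<Sum>p\<in>ends ` B. dist (\<beta> (fst p)) (\<beta> (snd p))) = (\<Sum>z\<in>B. g z)"
      unfolding sum.reindex[OF inj] by (simp add: g_def ends_def)
    ultimately have bad: "(\<Sum>z\<in>B. g z) \<le> \<epsilon>" by linarith
    note tel = additive_tagged_division_1[OF cd(2) T(1)]
    have "\<phi> d - \<phi> c = (\<Sum>(x, K)\<in>T. \<phi> (Sup K) - \<phi> (Inf K))" using tel[of \<phi>] by simp
    also have "\<dots> \<le> (\<Sum>(x, K)\<in>T. (G (Sup K) - G (Inf K)) + \<epsilon> * (Sup K - Inf K)
        + (if (x, K) \<in> B then g (x, K) else 0))"
      by (rule sum_mono) (use pt in auto)
    also have "\<dots> = (\<Sum>(x, K)\<in>T. G (Sup K) - G (Inf K)) + \<epsilon> * (\<Sum>(x, K)\<in>T. Sup K - Inf K)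
        + (\<Sum>z\<in>T. if z \<in> B then g z else 0)"
      by (simp add: sum.distrib split_def sum_distrib_left cong: if_cong)
    also have "(\<Sum>z\<in>T. if z \<in> B then g z else 0) = (\<Sum>z\<in>B. g z)"
      by (rule sum.mono_neutral_cong_right) (auto simp: finT B_def)
    also have "(\<Sum>(x, K)\<in>T. G (Sup K) - G (Inf K)) = G d - G c" using tel[of G] by simp
    also have "(\<Sum>(x, K)\<in>T. Sup K - Inf K) = d - c" using tel[of "\<lambda>x. x"] by simp
    finally show ?thesis using bad by linarith
  qed
  note est = this
  have "\<phi> d - \<phi> c \<le> G d - G c"
  proof (rule field_le_epsilon)
    fix e :: real assume "e > 0"
    \<comment> \<open>The summand 1 absorbs the second error term and keeps the denominator positive
      when c = d.\<close>
    define \<epsilon> where "\<epsilon> = e / (d - c + 1)"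
    have "\<epsilon> > 0" and e: "\<epsilon> * (d - c + 1) = e" using \<open>e > 0\<close> cd by (auto simp: \<epsilon>_def)
    have "\<phi> d - \<phi> c \<le> G d - G c + \<epsilon> * (d - c) + \<epsilon>" by (rule est[OF \<open>\<epsilon> > 0\<close>])
    also have "\<dots> = G d - G c + \<epsilon> * (d - c + 1)" by (simp add: distrib_left)
    finally show "\<phi> d - \<phi> c \<le> G d - G c + e" unfolding e .
  qed
  then show ?thesis by (simp add: \<phi>_def)
qed

section \<open>Causal curves: distance bound, direction of time, reflection\<close>

text \<open>At almost every point m * \<bar>v\<bar> \<le> \<bar>da\<bar>, so near it the increments
  of \<beta> are at most those of \<alpha> / m up to an arbitrarily small multiple of the parameter
  difference. This is the local bound just integrated, with G = \<alpha> / m. Monotonicity keeps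
  \<alpha> between its end values, where m bounds f from below.\<close>

lemma causal_dist_le:
  assumes causal: "causal f a b \<alpha> \<beta>"
    and mono: "\<And>s t. a \<le> s \<Longrightarrow> s \<le> t \<Longrightarrow> t \<le> b \<Longrightarrow> \<alpha> s \<le> \<alpha> t"
    and cd: "a \<le> c" "c \<le> d" "d \<le> b" and "m > 0"
    and m: "\<And>x. \<alpha> c \<le> x \<Longrightarrow> x \<le> \<alpha> d \<Longrightarrow> m \<le> f x"
  shows "dist (\<beta> c) (\<beta> d) \<le> (\<alpha> d - \<alpha> c) / m"
proof -
  have "dist (\<beta> c) (\<beta> d) \<le> \<alpha> d / m - \<alpha> c / m"
  proof (rule dist_le_of_AE_local_bound[where a = a and b = b and \<alpha> = \<alpha>, OF _ cd])
    show "abs_cont_curve a b \<alpha> \<beta>" using causal by (simp add: causal_def)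
    show "\<alpha> s / m \<le> \<alpha> t / m" if "c \<le> s" "s \<le> t" "t \<le> d" for s t
      using mono[of s t] that cd \<open>m > 0\<close> by (simp add: divide_right_mono)
    have "AE t in lebesgue. t \<in> {a..b} \<longrightarrow>
        (\<exists>da v. (\<alpha> has_real_derivative da) (at t) \<and> has_metric_derivative a b \<beta> v t \<and>
                - (da\<^sup>2) + (f (\<alpha> t))\<^sup>2 * v\<^sup>2 \<le> 0)"
      using causal by (simp add: causal_def)
    then show "AE x in lebesgue. x \<in> {c..d} \<longrightarrow> (\<forall>\<epsilon>>0. \<forall>\<^sub>F y in at x within {c..d}.
        dist (\<beta> y) (\<beta> x) \<le> \<bar>\<alpha> y / m - \<alpha> x / m\<bar> + \<epsilon> * \<bar>y - x\<bar>)"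
    proof (rule AE_mp, intro AE_I2 impI allI)
      fix x \<epsilon> :: real
      assume *: "x \<in> {a..b} \<longrightarrow> (\<exists>da v. (\<alpha> has_real_derivative da) (at x) \<and>
          has_metric_derivative a b \<beta> v x \<and> - (da\<^sup>2) + (f (\<alpha> x))\<^sup>2 * v\<^sup>2 \<le> 0)"
        and x: "x \<in> {c..d}" and "\<epsilon> > 0"
      then obtain da v where da: "(\<alpha> has_real_derivative da) (at x)"
        and v: "has_metric_derivative a b \<beta> v x" and le: "- (da\<^sup>2) + (f (\<alpha> x))\<^sup>2 * v\<^sup>2 \<le> 0"
        using cd by auto
      have "m \<le> f (\<alpha> x)" using x cd by (intro m mono) auto
      moreover have "\<bar>f (\<alpha> x) * v\<bar> \<le> \<bar>da\<bar>"
        using le by (intro power2_le_iff_abs_le[THEN iffD1]) (auto simp: power_mult_distrib)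
      moreover have "m * \<bar>v\<bar> \<le> f (\<alpha> x) * \<bar>v\<bar>"
        using \<open>m \<le> f (\<alpha> x)\<close> by (intro mult_right_mono) auto
      ultimately have "m * \<bar>v\<bar> \<le> \<bar>da\<bar>"
        using \<open>m > 0\<close> by (simp add: abs_mult)
      then have "\<bar>v\<bar> \<le> \<bar>da\<bar> / m" using \<open>m > 0\<close> by (simp add: field_simps)
      then have vda: "v \<le> \<bar>da\<bar> / m" by simp
      have "((\<lambda>y. dist (\<beta> y) (\<beta> x) / \<bar>y - x\<bar>) \<longlongrightarrow> v) (at x within {c..d})"
        using v unfolding has_metric_derivative_def
        by (rule tendsto_within_subset) (use cd in auto)
      then have 1: "\<forall>\<^sub>F y in at x within {c..d}. dist (\<beta> y) (\<beta> x) / \<bar>y - x\<bar> < v + \<epsilon> / 2"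
        using \<open>\<epsilon> > 0\<close> by (intro order_tendstoD(2)) auto
      have "((\<lambda>y. (\<alpha> y - \<alpha> x) / (y - x)) \<longlongrightarrow> da) (at x within {c..d})"
        using da by (auto simp: has_field_derivative_iff intro: tendsto_within_subset)
      then have "((\<lambda>y. \<bar>(\<alpha> y - \<alpha> x) / (y - x)\<bar> / m) \<longlongrightarrow> \<bar>da\<bar> / m) (at x within {c..d})"
        using \<open>m > 0\<close> by (intro tendsto_intros) auto
      then have 2: "\<forall>\<^sub>F y in at x within {c..d}. \<bar>da\<bar> / m - \<epsilon> / 2 < \<bar>(\<alpha> y - \<alpha> x) / (y - x)\<bar> / m"
        using \<open>\<epsilon> > 0\<close> by (intro order_tendstoD(1)) auto
      have 3: "\<forall>\<^sub>F y in at x within {c..d}. y \<noteq> x"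
        by (simp add: eventually_at_filter)
      show "\<forall>\<^sub>F y in at x within {c..d}.
          dist (\<beta> y) (\<beta> x) \<le> \<bar>\<alpha> y / m - \<alpha> x / m\<bar> + \<epsilon> * \<bar>y - x\<bar>"
        using 1 2 3
      proof eventually_elim
        case (elim y)
        then have "dist (\<beta> y) (\<beta> x) / \<bar>y - x\<bar> \<le> \<bar>(\<alpha> y - \<alpha> x) / (y - x)\<bar> / m + \<epsilon>"
          using vda by linarith
        then have "dist (\<beta> y) (\<beta> x) \<le> (\<bar>(\<alpha> y - \<alpha> x) / (y - x)\<bar> / m + \<epsilon>) * \<bar>y - x\<bar>"
          using elim(3) by (simp add: pos_divide_le_eq)
        also have "\<dots> = \<bar>\<alpha> y - \<alpha> x\<bar> / m + \<epsilon> * \<bar>y - x\<bar>"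
          using elim(3) by (simp add: distrib_right abs_divide)
        also have "\<bar>\<alpha> y - \<alpha> x\<bar> / m = \<bar>\<alpha> y / m - \<alpha> x / m\<bar>"
          using \<open>m > 0\<close> by (simp add: diff_divide_distrib[symmetric] abs_divide)
        finally show ?case .
      qed
    qed
  qed
  then show ?thesis by (simp add: diff_divide_distrib)
qed

text \<open>A causal curve has \<alpha> strictly monotone in one of two senses; a single interior
  point with positive derivative excludes the decreasing one.\<close>

lemma future_directed_increasing:
  assumes "future_directed_causal f a b \<alpha> \<beta>" "a \<le> s" "s \<le> t" "t \<le> b"
  shows "\<alpha> s \<le> \<alpha> t"
proof (cases "s = t")
  case False
  then have "s < t" "a < b" using assms by auto
  have pos: "AE t in lebesgue. t \<in> {a..b} \<longrightarrow> (\<exists>da. (\<alpha> has_real_derivative da) (at t) \<and> da > 0)"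
    using assms(1) by (simp add: future_directed_causal_def)
  obtain N where "N \<in> null_sets lebesgue"
    and N: "\<And>t. t \<in> space lebesgue - N \<Longrightarrow> t \<in> {a..b} \<longrightarrow> (\<exists>da. (\<alpha> has_real_derivative da) (at t) \<and> da > 0)"
    using AE_E3[OF pos] by blast
  then have "negligible N" by (simp add: negligible_iff_null_sets)
  then have "\<not> {a<..<b} \<subseteq> N"
    using open_not_negligible[of "{a<..<b}"] negligible_subset \<open>a < b\<close> by auto
  then obtain x where "x \<in> {a<..<b}" and xN: "x \<notin> N" by blast
  then have x: "a < x" "x < b" by auto
  then obtain da where "(\<alpha> has_real_derivative da) (at x)" "da > 0"
    using N[of x] x xN by auto
  then obtain d where "d > 0" and d: "\<And>h. 0 < h \<Longrightarrow> h < d \<Longrightarrow> \<alpha> x < \<alpha> (x + h)"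
    using DERIV_pos_inc_right by blast
  define y where "y = x + min (d / 2) ((b - x) / 2)"
  have y: "x < y" "y < b" using x \<open>d > 0\<close> by (auto simp: y_def min_def field_simps)
  have "\<alpha> x < \<alpha> y" unfolding y_def using x \<open>d > 0\<close> by (intro d) (auto simp: min_def)
  then have "\<not> (\<forall>s\<in>{a..b}. \<forall>t\<in>{a..b}. s < t \<longrightarrow> \<alpha> s > \<alpha> t)"
    using x y by (intro notI) (force dest: bspec[of _ _ x] bspec[of _ _ y])
  then have "\<forall>s\<in>{a..b}. \<forall>t\<in>{a..b}. s < t \<longrightarrow> \<alpha> s < \<alpha> t"
    using assms(1) by (auto simp: future_directed_causal_def causal_def)
  then show ?thesis using \<open>s < t\<close> assms by (force intro: less_imp_le)
qed simp

lemma abs_cont_curve_uminus: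
  "abs_cont_curve a b \<alpha> \<beta> \<Longrightarrow> abs_cont_curve a b (\<lambda>t. - \<alpha> t) \<beta>"
  by (simp add: abs_cont_curve_def Dmet_def abs_minus_commute)

text \<open>Reflecting the time axis preserves the causality inequality, as only the square of the
  derivative occurs, provided that f is reflected too. It exchanges past and future directed
  curves.\<close>

lemma causal_uminus:
  assumes "causal f a b \<alpha> \<beta>"
  shows "causal (\<lambda>x. f (- x)) a b (\<lambda>t. - \<alpha> t) \<beta>"
proof -
  have "AE t in lebesgue. t \<in> {a..b} \<longrightarrow>
        (\<exists>da v. (\<alpha> has_real_derivative da) (at t) \<and> has_metric_derivative a b \<beta> v t \<and>
                - (da\<^sup>2) + (f (\<alpha> t))\<^sup>2 * v\<^sup>2 \<le> 0)"
    using assms by (simp add: causal_def)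
  then have "AE t in lebesgue. t \<in> {a..b} \<longrightarrow>
        (\<exists>da v. ((\<lambda>t. - \<alpha> t) has_real_derivative da) (at t) \<and> has_metric_derivative a b \<beta> v t \<and>
                - (da\<^sup>2) + (f (- (- \<alpha> t)))\<^sup>2 * v\<^sup>2 \<le> 0)"
    by eventually_elim (auto, metis DERIV_minus power2_minus)
  then show ?thesis
    using assms abs_cont_curve_uminus[of a b \<alpha> \<beta>] unfolding causal_def by auto
qed

section \<open>Pointwise limits of causal curves\<close>

text \<open>The values of the approximating curves are only close to those of the limit; the margins
  on both sides leave room for them inside a compact part of I.\<close>

lemma open_interval_enlarge:
  fixes I :: "real set"
  assumes "open I" "is_interval I" "x \<in> I" "y \<in> I"
  obtains lo hi where "lo < x" "y < hi" "{lo..hi} \<subseteq> I"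
proof -
  obtain r where r: "r > 0" "cball x r \<subseteq> I" using assms open_contains_cball by blast
  obtain r' where r': "r' > 0" "cball y r' \<subseteq> I" using assms open_contains_cball by blast
  have "x - r \<in> I" "y + r' \<in> I" using r r' by (auto simp: dist_real_def subset_iff)
  then have "{x - r..y + r'} \<subseteq> I" 
    using mem_is_interval_1_I[OF assms(2), of "x - r" "y + r'"] by auto
  then show thesis using r r' by (intro that[of "x - r" "y + r'"]) auto
qed

text \<open>Convergence at the two parameters c and d suffices, without uniformity: each
  \<open>\<alpha>s n\<close> is monotone, so once its values at c and d lie within the margins, all
  values in between do, and m bounds f along that piece of the curve.\<close>

lemma causal_limit_dist_le:
  assumes causal: "\<And>n. causal f a b (\<alpha>s n) (\<beta>s n)"
    and inc: "\<And>n s t. a \<le> s \<Longrightarrow> s \<le> t \<Longrightarrow> t \<le> b \<Longrightarrow> \<alpha>s n s \<le> \<alpha>s n t"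
    and conv: "\<And>t. t \<in> {a..b} \<Longrightarrow> (\<lambda>n. \<alpha>s n t) \<longlonglongrightarrow> \<alpha> t \<and> (\<lambda>n. \<beta>s n t) \<longlonglongrightarrow> \<beta> t"
    and cd: "a \<le> c" "c \<le> d" "d \<le> b" and "m > 0" "lo < \<alpha> c" "\<alpha> d < hi"
    and m: "\<And>x. x \<in> {lo..hi} \<Longrightarrow> m \<le> f x"
  shows "dist (\<beta> c) (\<beta> d) \<le> (\<alpha> d - \<alpha> c) / m"
proof (rule tendsto_le[OF sequentially_bot])
  have c: "(\<lambda>n. \<alpha>s n c) \<longlonglongrightarrow> \<alpha> c" "(\<lambda>n. \<beta>s n c) \<longlonglongrightarrow> \<beta> c" using conv[of c] cd by auto
  have d: "(\<lambda>n. \<alpha>s n d) \<longlonglongrightarrow> \<alpha> d" "(\<lambda>n. \<beta>s n d) \<longlonglongrightarrow> \<beta> d" using conv[of d] cd by auto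
  show "(\<lambda>n. dist (\<beta>s n c) (\<beta>s n d)) \<longlonglongrightarrow> dist (\<beta> c) (\<beta> d)"
    by (intro tendsto_dist c d)
  show "(\<lambda>n. (\<alpha>s n d - \<alpha>s n c) / m) \<longlonglongrightarrow> (\<alpha> d - \<alpha> c) / m"
    using \<open>m > 0\<close> by (intro tendsto_intros c d) auto
  have "\<forall>\<^sub>F n in sequentially. lo < \<alpha>s n c" "\<forall>\<^sub>F n in sequentially. \<alpha>s n d < hi"
    using order_tendstoD(1)[OF c(1)] order_tendstoD(2)[OF d(1)] assms by auto
  then show "\<forall>\<^sub>F n in sequentially. dist (\<beta>s n c) (\<beta>s n d) \<le> (\<alpha>s n d - \<alpha>s n c) / m"
  proof eventually_elim
    case (elim n)
    then show ?case
      by (intro causal_dist_le[OF causal inc cd \<open>m > 0\<close>]) (auto intro!: m)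
  qed
qed

lemma strictly_increasing_of_deriv_nonzero:
  fixes \<alpha> :: "real \<Rightarrow> real"
  assumes inc: "\<And>s t. a \<le> s \<Longrightarrow> s \<le> t \<Longrightarrow> t \<le> b \<Longrightarrow> \<alpha> s \<le> \<alpha> t"
    and nz: "AE t in lebesgue. t \<in> {a..b} \<longrightarrow> (\<exists>da. (\<alpha> has_real_derivative da) (at t) \<and> da \<noteq> 0)"
    and st: "a \<le> s" "s < t" "t \<le> b"
  shows "\<alpha> s < \<alpha> t"
proof (rule ccontr)
  assume "\<not> ?thesis"
  then have eq: "\<alpha> x = \<alpha> s" if "x \<in> {s<..<t}" for x
    using inc[of s x] inc[of x t] st that by auto
  obtain N where "N \<in> null_sets lebesgue"
    and N: "\<And>t. t \<in> space lebesgue - N \<Longrightarrow> t \<in> {a..b} \<longrightarrow> (\<exists>da. (\<alpha> has_real_derivative da) (at t) \<and> da \<noteq> 0)"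
    using AE_E3[OF nz] by blast
  then have "negligible N" by (simp add: negligible_iff_null_sets)
  then have "\<not> {s<..<t} \<subseteq> N"
    using open_not_negligible[of "{s<..<t}"] negligible_subset st by auto
  then obtain x where x: "x \<in> {s<..<t}" "x \<notin> N" by blast
  then obtain da where da: "(\<alpha> has_real_derivative da) (at x)" "da \<noteq> 0" using N[of x] st by auto
  have "(\<alpha> has_real_derivative 0) (at x)"
    by (rule has_field_derivative_transform_within_open[of "\<lambda>_. \<alpha> s" _ _ "{s<..<t}"])
      (use x eq in auto)
  then show False using da DERIV_unique by blast
qed

lemma causal_limit_of_increasing:
  fixes I :: "real set" and f :: "real \<Rightarrow> real" and \<beta> :: "real \<Rightarrow> 'a::metric_space"
  assumes I: "open I" "is_interval I"
    and f_cont: "continuous_on I f" and f_pos: "\<And>t. t \<in> I \<Longrightarrow> f t > 0"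
    and \<alpha>I: "\<And>t. t \<in> {a..b} \<Longrightarrow> \<alpha> t \<in> I"
    and ac: "abs_cont_curve a b \<alpha> \<beta>"
    and causal: "\<And>n. causal f a b (\<alpha>s n) (\<beta>s n)"
    and inc: "\<And>n s t. a \<le> s \<Longrightarrow> s \<le> t \<Longrightarrow> t \<le> b \<Longrightarrow> \<alpha>s n s \<le> \<alpha>s n t"
    and nz: "AE t in lebesgue. t \<in> {a..b} \<longrightarrow> (\<exists>da. (\<alpha> has_real_derivative da) (at t) \<and> da \<noteq> 0)"
    and conv: "\<And>t. t \<in> {a..b} \<Longrightarrow> (\<lambda>n. \<alpha>s n t) \<longlonglongrightarrow> \<alpha> t \<and> (\<lambda>n. \<beta>s n t) \<longlonglongrightarrow> \<beta> t"
    and "a \<le> b"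
  shows "causal f a b \<alpha> \<beta>"
proof -
  have mono: "\<alpha> s \<le> \<alpha> t" if "a \<le> s" "s \<le> t" "t \<le> b" for s t
    by (rule LIMSEQ_le[of "\<lambda>n. \<alpha>s n s" _ "\<lambda>n. \<alpha>s n t"]) (use conv inc that in auto)
  have strict: "\<alpha> s < \<alpha> t" if "a \<le> s" "s < t" "t \<le> b" for s t
    by (rule strictly_increasing_of_deriv_nonzero[OF mono nz that])
  note limit_dist = causal_limit_dist_le[where a = a and b = b and \<alpha>s = \<alpha>s and \<alpha> = \<alpha>, OF causal inc conv]
  obtain lo hi where lohi: "lo < \<alpha> a" "\<alpha> b < hi" "{lo..hi} \<subseteq> I"
    using open_interval_enlarge[OF I \<alpha>I \<alpha>I, of a b] \<open>a \<le> b\<close> by auto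
  have "lo \<le> hi" using lohi mono[of a b] \<open>a \<le> b\<close> by auto
  then obtain x0 where x0: "x0 \<in> {lo..hi}" "\<And>x. x \<in> {lo..hi} \<Longrightarrow> f x0 \<le> f x"
    using continuous_attains_inf[of "{lo..hi}" f] continuous_on_subset[OF f_cont lohi(3)]
    by auto
  \<comment> \<open>A crude constant, valid along the whole curve. It gives rectifiability and
    bounded difference quotients; the sharp inequality needs a local constant instead.\<close>
  define m where "m = f x0"
  have "m > 0" using f_pos x0 lohi by (auto simp: m_def)
  have dom: "dist (\<beta> s) (\<beta> t) \<le> \<alpha> t / m - \<alpha> s / m" if "a \<le> s" "s \<le> t" "t \<le> b" for s t
  proof -
    have "dist (\<beta> s) (\<beta> t) \<le> (\<alpha> t - \<alpha> s) / m"
      using mono[of a s] mono[of t b] that lohi \<open>m > 0\<close> x0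
      by (intro limit_dist[where lo = lo and hi = hi]) (auto simp: m_def)
    then show ?thesis by (simp add: diff_divide_distrib)
  qed
  have "continuous_on {a<..<b} \<beta>"
    by (rule continuous_on_subset[OF abs_cont_curve_continuous[OF ac]]) auto
  then have osc: "AE t in lebesgue. t \<in> {a<..<b} \<longrightarrow> (\<forall>p\<in>\<rat>. \<forall>q\<in>\<rat>. 0 \<le> p \<longrightarrow> p < q \<longrightarrow>
           \<not> ((\<exists>\<^sub>F s in at t. dist (\<beta> s) (\<beta> t) < p * \<bar>s - t\<bar>) \<and>
              (\<exists>\<^sub>F s in at t. dist (\<beta> s) (\<beta> t) > q * \<bar>s - t\<bar>)))"
    by (rule AE_no_oscillation[rotated]) (rule dom)
  \<comment> \<open>Discarding the end points allows two-sided limits at t in place of limits within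
    [a, b].\<close>
  have "AE t in lebesgue. t \<notin> {a, b}"
    by (rule AE_not_in) (simp add: null_sets_completionI finite_imp_null_set_lborel)
  with osc nz have "AE t in lebesgue. t \<in> {a..b} \<longrightarrow>
        (\<exists>da v. (\<alpha> has_real_derivative da) (at t) \<and> has_metric_derivative a b \<beta> v t \<and>
                - (da\<^sup>2) + (f (\<alpha> t))\<^sup>2 * v\<^sup>2 \<le> 0)"
  proof eventually_elim
    case (elim t)
    show ?case
    proof
      assume "t \<in> {a..b}"
      then have t: "a < t" "t < b" using elim(3) by auto
      obtain da where da: "(\<alpha> has_real_derivative da) (at t)" using elim(2) \<open>t \<in> {a..b}\<close> by auto
      note osc_t = elim(1)
      define h where "h = (\<lambda>s. dist (\<beta> s) (\<beta> t) / \<bar>s - t\<bar>)"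
      define k where "k = (\<lambda>s. \<bar>(\<alpha> s - \<alpha> t) / (s - t)\<bar>)"
      have k: "(k \<longlongrightarrow> \<bar>da\<bar>) (at t)"
        unfolding k_def using da by (intro tendsto_rabs) (simp add: has_field_derivative_iff)
      have \<alpha>t: "(\<alpha> \<longlongrightarrow> \<alpha> t) (at t)" using DERIV_isCont[OF da] by (simp add: isCont_def)
      have near: "\<forall>\<^sub>F s in at t. s \<in> {a<..<b} - {t}"
        using t by (intro eventually_at_in_open) auto
      \<comment> \<open>The constant c is left free because the estimate serves twice: with m it
        bounds the quotients, and with c just below f at \<alpha> t it yields the causality
        inequality.\<close>
      have h_le: "\<forall>\<^sub>F s in at t. h s \<le> k s / c"
        if c: "0 < c" and lohi: "lo < \<alpha> t" "\<alpha> t < hi" and f: "\<And>x. x \<in> {lo..hi} \<Longrightarrow> c \<le> f x"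
        for c lo hi
        using near order_tendstoD(1)[OF \<alpha>t lohi(1)] order_tendstoD(2)[OF \<alpha>t lohi(2)]
      proof eventually_elim
        case (elim s)
        have "dist (\<beta> s) (\<beta> t) \<le> \<bar>\<alpha> s - \<alpha> t\<bar> / c"
        proof (cases "s < t")
          case True
          then have "dist (\<beta> s) (\<beta> t) \<le> (\<alpha> t - \<alpha> s) / c"
            using elim t lohi c f by (intro limit_dist[where lo = lo and hi = hi]) auto
          then show ?thesis using True elim t mono[of s t] by simp
        next
          case False
          then have "dist (\<beta> t) (\<beta> s) \<le> (\<alpha> s - \<alpha> t) / c"
            using elim t lohi c f by (intro limit_dist[where lo = lo and hi = hi]) auto
          then show ?thesis using False elim t mono[of t s] by (simp add: dist_commute)
        qed
        then have "h s \<le> \<bar>\<alpha> s - \<alpha> t\<bar> / c / \<bar>s - t\<bar>"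
          unfolding h_def by (rule divide_right_mono) simp
        then show ?case by (simp add: k_def abs_divide mult.commute)
      qed
      have h0: "0 \<le> h s" for s by (simp add: h_def)
      have "\<exists>v. (h \<longlongrightarrow> v) (at t)"
      proof (rule tendsto_if_no_oscillation)
        have "\<forall>\<^sub>F s in at t. h s \<le> k s / m"
          using lohi mono[of a t] mono[of t b] t x0 \<open>m > 0\<close>
          by (intro h_le[of m lo hi]) (auto simp: m_def)
        moreover have "\<forall>\<^sub>F s in at t. k s < \<bar>da\<bar> + 1" by (rule order_tendstoD(2)[OF k]) simp
        ultimately show "\<forall>\<^sub>F s in at t. 0 \<le> h s \<and> h s \<le> (\<bar>da\<bar> + 1) / m"
        proof eventually_elim
          case (elim s)
          then have "k s / m \<le> (\<bar>da\<bar> + 1) / m" using \<open>m > 0\<close> by (intro divide_right_mono) auto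
          then show ?case using elim h0 by auto
        qed
        have ne: "\<forall>\<^sub>F s in at t. s \<noteq> t" by (simp add: eventually_at_filter)
        fix p q :: real assume pq: "p \<in> \<rat>" "q \<in> \<rat>" "0 \<le> p" "p < q"
        have "(\<exists>\<^sub>F s in at t. h s < p) \<Longrightarrow> \<exists>\<^sub>F s in at t. dist (\<beta> s) (\<beta> t) < p * \<bar>s - t\<bar>"
          by (erule frequently_rev_mp, use ne in eventually_elim) (simp add: h_def pos_divide_less_eq)
        moreover have "(\<exists>\<^sub>F s in at t. h s > q) \<Longrightarrow> \<exists>\<^sub>F s in at t. dist (\<beta> s) (\<beta> t) > q * \<bar>s - t\<bar>"
          by (erule frequently_rev_mp, use ne in eventually_elim) (simp add: h_def pos_less_divide_eq)
        ultimately show "\<not> ((\<exists>\<^sub>F s in at t. h s < p) \<and> (\<exists>\<^sub>F s in at t. h s > q))"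
          using osc_t t pq by auto
      qed simp
      then obtain v where v: "(h \<longlongrightarrow> v) (at t)" ..
      have "0 \<le> v" by (rule tendsto_lowerbound[OF v]) (auto simp: h0)
      \<comment> \<open>By continuity f exceeds c in a neighbourhood of \<alpha> t, so
        \<open>h_le\<close> applies there; both sides then pass to the limit at t.\<close>
      have "c * v \<le> \<bar>da\<bar>" if c: "0 < c" "c < f (\<alpha> t)" for c
      proof -
        have "open (I \<inter> f -` {c<..})" by (rule continuous_open_preimage[OF f_cont I(1)]) simp
        moreover have "\<alpha> t \<in> I \<inter> f -` {c<..}" using \<alpha>I t c by auto
        ultimately obtain r where r: "r > 0" "cball (\<alpha> t) r \<subseteq> I \<inter> f -` {c<..}"
          using open_contains_cball by blast
        have "\<forall>\<^sub>F s in at t. h s \<le> k s / c"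
        proof (rule h_le[of c "\<alpha> t - r" "\<alpha> t + r"])
          fix x assume "x \<in> {\<alpha> t - r..\<alpha> t + r}"
          then have "x \<in> cball (\<alpha> t) r" by (simp add: cball_eq_atLeastAtMost)
          then show "c \<le> f x" using r by auto
        qed (use r c in auto)
        moreover have "((\<lambda>s. k s / c) \<longlongrightarrow> \<bar>da\<bar> / c) (at t)"
          using c by (intro tendsto_intros k) auto
        ultimately have "v \<le> \<bar>da\<bar> / c" using v by (intro tendsto_le) auto
        then show ?thesis using c by (simp add: field_simps)
      qed
      \<comment> \<open>Now c increases to f at \<alpha> t. As that value is positive, the
        admissible c form a left neighbourhood of it.\<close>
      then have "((\<lambda>c. c * v) \<longlongrightarrow> f (\<alpha> t) * v) (at_left (f (\<alpha> t)))"
        and ev: "\<forall>\<^sub>F c in at_left (f (\<alpha> t)). c * v \<le> \<bar>da\<bar>"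
        using f_pos[OF \<alpha>I, of t] t
        by (auto intro!: tendsto_intros simp: eventually_at_left[of 0])
      then have "f (\<alpha> t) * v \<le> \<bar>da\<bar>"
        by (intro tendsto_upperbound) auto
      then have "(f (\<alpha> t) * v)\<^sup>2 \<le> \<bar>da\<bar>\<^sup>2"
        using \<open>0 \<le> v\<close> f_pos[OF \<alpha>I, of t] t by (intro power_mono) auto
      then have "- (da\<^sup>2) + (f (\<alpha> t))\<^sup>2 * v\<^sup>2 \<le> 0" by (simp add: power_mult_distrib)
      moreover have "has_metric_derivative a b \<beta> v t"
        using v t by (simp add: has_metric_derivative_def h_def at_within_Icc_at)
      ultimately show "\<exists>da v. (\<alpha> has_real_derivative da) (at t) \<and> has_metric_derivative a b \<beta> v t \<and>
          - (da\<^sup>2) + (f (\<alpha> t))\<^sup>2 * v\<^sup>2 \<le> 0"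
        using da by blast
    qed
  qed
  then show ?thesis using ac strict unfolding causal_def by auto
qed

theorem theorem3p16:
  fixes I :: "real set" and f :: "real \<Rightarrow> real" and a b :: real
    and \<alpha>s :: "nat \<Rightarrow> real \<Rightarrow> real" and \<beta>s :: "nat \<Rightarrow> real \<Rightarrow> 'a::metric_space"
    and \<alpha> :: "real \<Rightarrow> real" and \<beta> :: "real \<Rightarrow> 'a"
  assumes I_open: "open I" and I_interval: "is_interval I" and I_ne: "I \<noteq> {}"
    and f_cont: "continuous_on I f" and f_pos: "\<forall>t\<in>I. f t > 0"
    and curves_n_in_Y: "\<forall>n. \<forall>t\<in>{a..b}. \<alpha>s n t \<in> I"
    and curve_in_Y: "\<forall>t\<in>{a..b}. \<alpha> t \<in> I"
    and ac_n: "\<forall>n. abs_cont_curve a b (\<alpha>s n) (\<beta>s n)"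
    and ac: "abs_cont_curve a b \<alpha> \<beta>"
    and directed: "(\<forall>n. future_directed_causal f a b (\<alpha>s n) (\<beta>s n)) \<or>
                   (\<forall>n. past_directed_causal f a b (\<alpha>s n) (\<beta>s n))"
    and alpha_deriv_nonzero:
      "AE t in lebesgue. t \<in> {a..b} \<longrightarrow> (\<exists>da. (\<alpha> has_real_derivative da) (at t) \<and> da \<noteq> 0)"
    and conv: "\<forall>t\<in>{a..b}. (\<lambda>n. \<alpha>s n t) \<longlonglongrightarrow> \<alpha> t \<and> (\<lambda>n. \<beta>s n t) \<longlonglongrightarrow> \<beta> t"
  shows "causal f a b \<alpha> \<beta>"
proof (cases "a \<le> b")
  case False
  \<comment> \<open>The parameter interval is empty, so everything except absolute continuity holds
    vacuously.\<close>
  then show ?thesis using ac by (auto simp: causal_def)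
next
  case True
  from directed show ?thesis
  proof
    assume fut: "\<forall>n. future_directed_causal f a b (\<alpha>s n) (\<beta>s n)"
    show ?thesis
    proof (rule causal_limit_of_increasing[OF I_open I_interval f_cont])
      show "causal f a b (\<alpha>s n) (\<beta>s n)" for n
        using fut by (simp add: future_directed_causal_def)
      show "\<alpha>s n s \<le> \<alpha>s n t" if "a \<le> s" "s \<le> t" "t \<le> b" for n s t
        using future_directed_increasing fut that by blast
    qed (use True f_pos curve_in_Y ac alpha_deriv_nonzero conv in auto)
  next
    assume past: "\<forall>n. past_directed_causal f a b (\<alpha>s n) (\<beta>s n)"
    have fut: "future_directed_causal (\<lambda>x. f (- x)) a b (\<lambda>t. - \<alpha>s n t) (\<beta>s n)" for n
    proof -
      have "AE t in lebesgue. t \<in> {a..b} \<longrightarrow> (\<exists>da. (\<alpha>s n has_real_derivative da) (at t) \<and> da < 0)"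
        using past by (simp add: past_directed_causal_def)
      then have "AE t in lebesgue. t \<in> {a..b} \<longrightarrow>
          (\<exists>da. ((\<lambda>t. - \<alpha>s n t) has_real_derivative da) (at t) \<and> da > 0)"
        by eventually_elim (auto, metis DERIV_minus neg_0_less_iff_less)
      then show ?thesis
        using past causal_uminus[of f a b "\<alpha>s n" "\<beta>s n"]
        by (simp add: past_directed_causal_def future_directed_causal_def)
    qed
    have "causal (\<lambda>x. f (- x)) a b (\<lambda>t. - \<alpha> t) \<beta>"
    proof (rule causal_limit_of_increasing[of "uminus ` I"])
      show "open (uminus ` I)" using I_open by (rule open_negations)
      show "is_interval (uminus ` I)" using I_interval by simp
      show "continuous_on (uminus ` I) (\<lambda>x. f (- x))"
        by (rule continuous_on_compose2[OF f_cont]) (auto intro!: continuous_intros)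
      show "abs_cont_curve a b (\<lambda>t. - \<alpha> t) \<beta>" using ac by (rule abs_cont_curve_uminus)
      show "causal (\<lambda>x. f (- x)) a b (\<lambda>t. - \<alpha>s n t) (\<beta>s n)" for n
        using fut by (simp add: future_directed_causal_def)
      show "- \<alpha>s n s \<le> - \<alpha>s n t" if "a \<le> s" "s \<le> t" "t \<le> b" for n s t
        using future_directed_increasing[OF fut that] .
      show "AE t in lebesgue. t \<in> {a..b} \<longrightarrow>
          (\<exists>da. ((\<lambda>t. - \<alpha> t) has_real_derivative da) (at t) \<and> da \<noteq> 0)"
        using alpha_deriv_nonzero
        by eventually_elim (auto, metis DERIV_minus neg_equal_0_iff_equal)
      show "(\<lambda>n. - \<alpha>s n t) \<longlonglongrightarrow> - \<alpha> t \<and> (\<lambda>n. \<beta>s n t) \<longlonglongrightarrow> \<beta> t" if "t \<in> {a..b}" for t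
        using conv that by (auto intro: tendsto_minus)
    qed (use True f_pos curve_in_Y in auto)
    \<comment> \<open>A second reflection undoes the first, for \<alpha> as well as for f.\<close>
    from causal_uminus[OF this] show ?thesis by simp
  qed
qed

end
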